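(* The Lie group $L$ admits a left-invariant non-trivial generalized Kähler structure; that is, there exist left-invariant complex structures $J_+,J_-$ on $L$ with $J_-\neq\pm J_+$ and a left-invariant Riemannian metric $g$ on $L$ such that $(J_+,J_-,g)$ is a generalized Kähler structure on $L$.
   Context: Let $\mathfrak{l}$ be the 6-dimensional real Lie algebra whose dual has a basis $(f^1,\dots,f^6)$ with structure equations $$df^1=f^1\wedge f^2,\quad df^2=0,\quad df^j=\tfrac12 f^2\wedge f^j\ \ (j=3,4,5,6),$$ and let $L$ be the simply connected Lie group with Lie algebra $\mathfrak{l}$. A generalized Kähler structure on an even-dimensional manifold $M$ is a triple $(J_+,J_-,g)$, where $J_\pm$ are integrable almost complex structures on $M$ and $g$ is a Riemannian metric that is Hermitian with respect to both $J_+$ and $J_-$, such that, with $F_\pm(\cdot,\cdot)=g(J_\pm\cdot,\cdot)$ and $d^c_\pm=i(\overline{\partial}_\pm-\partial_\pm)$, $$d^c_+F_++d^c_-F_-=0,\qquad d(d^c_+F_+)=0,\qquad d(d^c_-F_-)=0.$$ It is non-trivial if $J_-\neq\pm J_+$. *)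

theory Defs
  imports "HOL-Analysis.Analysis" "HOL-Algebra.Group"
begin

section \<open>Smooth maps between open subsets of Euclidean spaces\<close>

text \<open>Class C^k on an open set, by iterated directional derivatives.\<close>

primrec Ck_on :: "nat \<Rightarrow> 'e::euclidean_space set \<Rightarrow> ('e \<Rightarrow> 'f::real_normed_vector) \<Rightarrow> bool" where
  "Ck_on 0 S f = continuous_on S f"
| "Ck_on (Suc k) S f =
     ((\<forall>x\<in>S. f differentiable (at x)) \<and> (\<forall>v. Ck_on k S (\<lambda>x. frechet_derivative f (at x) v)))"

definition smooth_on :: "'e::euclidean_space set \<Rightarrow> ('e \<Rightarrow> 'f::real_normed_vector) \<Rightarrow> bool" where
  "smooth_on S f \<longleftrightarrow> (\<forall>k. Ck_on k S f)"


section \<open>Manifolds and Lie groups\<close>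

text \<open>A chart is a pair of its domain and its coordinate map. Hausdorffness and second
  countability of a manifold come from the type class of the ambient type.\<close>

type_synonym ('a, 'e) chart = "'a set \<times> ('a \<Rightarrow> 'e)"

definition cdom :: "('a, 'e) chart \<Rightarrow> 'a set" where
  "cdom c = fst c"

definition cmap :: "('a, 'e) chart \<Rightarrow> 'a \<Rightarrow> 'e" where
  "cmap c = snd c"

definition cimg :: "('a, 'e) chart \<Rightarrow> 'e set" where
  "cimg c = cmap c ` cdom c"

definition cinv :: "('a, 'e) chart \<Rightarrow> 'e \<Rightarrow> 'a" where
  "cinv c = inv_into (cdom c) (cmap c)"

definition smooth_atlas ::
  "'a::{t2_space,second_countable_topology} set \<Rightarrow> ('a, 'e::euclidean_space) chart set \<Rightarrow> bool" where
  "smooth_atlas M A \<longleftrightarrow>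
     (\<Union>c\<in>A. cdom c) = M \<and>
     (\<forall>c\<in>A. openin (top_of_set M) (cdom c) \<and> open (cimg c) \<and>
             homeomorphism (cdom c) (cimg c) (cmap c) (cinv c)) \<and>
     (\<forall>c\<in>A. \<forall>d\<in>A. smooth_on (cmap c ` (cdom c \<inter> cdom d)) (cmap d \<circ> cinv c))"

definition prod_atlas ::
  "('a, 'e) chart set \<Rightarrow> ('b, 'f) chart set \<Rightarrow> ('a \<times> 'b, 'e \<times> 'f) chart set" where
  "prod_atlas A B = {(cdom c \<times> cdom d, map_prod (cmap c) (cmap d)) | c d. c \<in> A \<and> d \<in> B}"

definition local_rep :: "('a, 'e) chart \<Rightarrow> ('b, 'f) chart \<Rightarrow> ('a \<Rightarrow> 'b) \<Rightarrow> 'e \<Rightarrow> 'f" where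
  "local_rep c d h = cmap d \<circ> h \<circ> cinv c"

definition smooth_map ::
  "'a::topological_space set \<Rightarrow> ('a, 'e::euclidean_space) chart set \<Rightarrow>
   'b::topological_space set \<Rightarrow> ('b, 'f::euclidean_space) chart set \<Rightarrow> ('a \<Rightarrow> 'b) \<Rightarrow> bool" where
  "smooth_map M A N B h \<longleftrightarrow>
     h ` M \<subseteq> N \<and> continuous_on M h \<and>
     (\<forall>c\<in>A. \<forall>d\<in>B. smooth_on {x \<in> cimg c. h (cinv c x) \<in> cdom d} (local_rep c d h))"

definition lie_group ::
  "('a::{t2_space,second_countable_topology}, 'm) monoid_scheme \<Rightarrow>
   ('a, 'e::euclidean_space) chart set \<Rightarrow> bool" where
  "lie_group G A \<longleftrightarrow>
     group G \<and> smooth_atlas (carrier G) A \<and>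
     smooth_map (carrier G \<times> carrier G) (prod_atlas A A) (carrier G) A (\<lambda>(a, b). a \<otimes>\<^bsub>G\<^esub> b) \<and>
     smooth_map (carrier G) A (carrier G) A (\<lambda>a. inv\<^bsub>G\<^esub> a)"


section \<open>Tensor fields\<close>

text \<open>A tensor field on a manifold is given by its local representatives: one tensor field on the
  image of each chart, related by the transition maps. A \<open>k\<close>-form at a point takes its
  arguments from a sequence of vectors, of which only the entries with index below \<open>k\<close> matter.
  Only the values of a local representative on the image of its chart are meaningful.\<close>

type_synonym ('e, 'b) local_form = "'e \<Rightarrow> (nat \<Rightarrow> 'e) \<Rightarrow> 'b"
type_synonym ('a, 'e, 'b) form_field = "('a, 'e) chart \<Rightarrow> ('e, 'b) local_form"
type_synonym ('a, 'e) endo_field = "('a, 'e) chart \<Rightarrow> 'e \<Rightarrow> 'e \<Rightarrow> 'e"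
type_synonym ('a, 'e) metric_field = "('a, 'e) chart \<Rightarrow> 'e \<Rightarrow> 'e \<Rightarrow> 'e \<Rightarrow> real"

text \<open>Invariance of a field under a smooth map \<open>h\<close>. For \<open>h = id\<close> this says that
  the local representatives are compatible with the changes of charts.\<close>

definition form_invariant ::
  "('a, 'e::euclidean_space) chart set \<Rightarrow> ('a \<Rightarrow> 'a) \<Rightarrow> ('a, 'e, 'b) form_field \<Rightarrow> bool" where
  "form_invariant A h w \<longleftrightarrow>
     (\<forall>c\<in>A. \<forall>d\<in>A. \<forall>x\<in>cimg c. h (cinv c x) \<in> cdom d \<longrightarrow>
        (\<forall>v. w d (local_rep c d h x) (\<lambda>i. frechet_derivative (local_rep c d h) (at x) (v i))
             = w c x v))"

definition endo_invariant ::
  "('a, 'e::euclidean_space) chart set \<Rightarrow> ('a \<Rightarrow> 'a) \<Rightarrow> ('a, 'e) endo_field \<Rightarrow> bool" where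
  "endo_invariant A h J \<longleftrightarrow>
     (\<forall>c\<in>A. \<forall>d\<in>A. \<forall>x\<in>cimg c. h (cinv c x) \<in> cdom d \<longrightarrow>
        (\<forall>v. J d (local_rep c d h x) (frechet_derivative (local_rep c d h) (at x) v)
             = frechet_derivative (local_rep c d h) (at x) (J c x v)))"

definition metric_invariant ::
  "('a, 'e::euclidean_space) chart set \<Rightarrow> ('a \<Rightarrow> 'a) \<Rightarrow> ('a, 'e) metric_field \<Rightarrow> bool" where
  "metric_invariant A h g \<longleftrightarrow>
     (\<forall>c\<in>A. \<forall>d\<in>A. \<forall>x\<in>cimg c. h (cinv c x) \<in> cdom d \<longrightarrow>
        (\<forall>u v. g d (local_rep c d h x) (frechet_derivative (local_rep c d h) (at x) u)
                  (frechet_derivative (local_rep c d h) (at x) v)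
             = g c x u v))"

definition alternating_form ::
  "nat \<Rightarrow> ((nat \<Rightarrow> 'e::real_vector) \<Rightarrow> 'b::real_vector) \<Rightarrow> bool" where
  "alternating_form k w \<longleftrightarrow>
     (\<forall>v v'. (\<forall>i<k. v i = v' i) \<longrightarrow> w v = w v') \<and>
     (\<forall>v. \<forall>i<k. linear (\<lambda>u. w (v(i := u)))) \<and>
     (\<forall>v. \<forall>i<k. \<forall>j<k. i \<noteq> j \<and> v i = v j \<longrightarrow> w v = 0)"

definition form_on ::
  "('a, 'e::euclidean_space) chart set \<Rightarrow> nat \<Rightarrow> ('a, 'e, 'b::real_normed_vector) form_field \<Rightarrow> bool"
where
  "form_on A k w \<longleftrightarrow>
     (\<forall>c\<in>A. (\<forall>x\<in>cimg c. alternating_form k (w c x)) \<and> (\<forall>v. smooth_on (cimg c) (\<lambda>x. w c x v))) \<and>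
     form_invariant A id w"

definition almost_complex_structure_on ::
  "('a, 'e::euclidean_space) chart set \<Rightarrow> ('a, 'e) endo_field \<Rightarrow> bool" where
  "almost_complex_structure_on A J \<longleftrightarrow>
     (\<forall>c\<in>A. (\<forall>x\<in>cimg c. linear (J c x) \<and> (\<forall>v. J c x (J c x v) = - v)) \<and>
             (\<forall>v. smooth_on (cimg c) (\<lambda>x. J c x v))) \<and>
     endo_invariant A id J"

definition riemannian_metric_on ::
  "('a, 'e::euclidean_space) chart set \<Rightarrow> ('a, 'e) metric_field \<Rightarrow> bool" where
  "riemannian_metric_on A g \<longleftrightarrow>
     (\<forall>c\<in>A. (\<forall>x\<in>cimg c. bilinear (g c x) \<and> (\<forall>u v. g c x u v = g c x v u) \<and>
                         (\<forall>v. v \<noteq> 0 \<longrightarrow> g c x v v > 0)) \<and>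
             (\<forall>u v. smooth_on (cimg c) (\<lambda>x. g c x u v))) \<and>
     metric_invariant A id g"


section \<open>Integrability\<close>

definition lie_bracket ::
  "('e::euclidean_space \<Rightarrow> 'e) \<Rightarrow> ('e \<Rightarrow> 'e) \<Rightarrow> 'e \<Rightarrow> 'e" where
  "lie_bracket X Y x = frechet_derivative Y (at x) (X x) - frechet_derivative X (at x) (Y x)"

definition nijenhuis ::
  "('e::euclidean_space \<Rightarrow> 'e \<Rightarrow> 'e) \<Rightarrow> ('e \<Rightarrow> 'e) \<Rightarrow> ('e \<Rightarrow> 'e) \<Rightarrow> 'e \<Rightarrow> 'e" where
  "nijenhuis J X Y x =
     lie_bracket (\<lambda>y. J y (X y)) (\<lambda>y. J y (Y y)) x
     - J x (lie_bracket (\<lambda>y. J y (X y)) Y x)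
     - J x (lie_bracket X (\<lambda>y. J y (Y y)) x)
     - lie_bracket X Y x"

definition integrable_complex_on ::
  "('a, 'e::euclidean_space) chart set \<Rightarrow> ('a, 'e) endo_field \<Rightarrow> bool" where
  "integrable_complex_on A J \<longleftrightarrow>
     (\<forall>c\<in>A. \<forall>X Y. smooth_on (cimg c) X \<and> smooth_on (cimg c) Y \<longrightarrow>
        (\<forall>x\<in>cimg c. nijenhuis (J c) X Y x = 0))"

definition complex_structure_on ::
  "('a, 'e::euclidean_space) chart set \<Rightarrow> ('a, 'e) endo_field \<Rightarrow> bool" where
  "complex_structure_on A J \<longleftrightarrow> almost_complex_structure_on A J \<and> integrable_complex_on A J"


section \<open>Exterior calculus\<close>

text \<open>The normalisation of the exterior derivative and of the wedge product is the one in which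
  \<open>d\<alpha>(X, Y) = X(\<alpha>(Y)) - Y(\<alpha>(X)) - \<alpha>([X, Y])\<close> and
  \<open>(\<alpha> \<and> \<beta>)(X, Y) = \<alpha>(X) \<beta>(Y) - \<alpha>(Y) \<beta>(X)\<close> for 1-forms. In \<open>ext_d\<close> the
  argument sequence \<open>v\<close> is extended to constant vector fields, and the \<open>i\<close>-th argument is
  left out.\<close>

definition omit :: "nat \<Rightarrow> (nat \<Rightarrow> 'e) \<Rightarrow> nat \<Rightarrow> 'e" where
  "omit i v j = (if j < i then v j else v (Suc j))"

definition ext_d ::
  "nat \<Rightarrow> ('e::euclidean_space, 'b::real_normed_vector) local_form \<Rightarrow> ('e, 'b) local_form" where
  "ext_d k w x v = (\<Sum>i\<le>k. (-1) ^ i *\<^sub>R frechet_derivative (\<lambda>y. w y (omit i v)) (at x) (v i))"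

definition wedge1 ::
  "('e::euclidean_space, real) local_form \<Rightarrow> ('e, real) local_form \<Rightarrow> ('e, real) local_form" where
  "wedge1 \<alpha> \<beta> x v = \<alpha> x (\<lambda>_. v 0) * \<beta> x (\<lambda>_. v 1) - \<alpha> x (\<lambda>_. v 1) * \<beta> x (\<lambda>_. v 0)"

text \<open>A pair \<open>(a, b)\<close> stands for the complexified tangent vector \<open>a + \<i> b\<close>;
  \<open>cextend\<close> is the complex multilinear extension of a form to such vectors.\<close>

definition cextend :: "nat \<Rightarrow> ((nat \<Rightarrow> 'e) \<Rightarrow> complex) \<Rightarrow> (nat \<Rightarrow> 'e \<times> 'e) \<Rightarrow> complex" where
  "cextend k w z =
     (\<Sum>S\<in>Pow {..<k}. \<i> ^ card S * w (\<lambda>j. if j \<in> S then snd (z j) else fst (z j)))"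

text \<open>The components of a real vector in the eigenspaces of \<open>J\<close> for \<open>\<i>\<close> and \<open>-\<i>\<close>.\<close>

definition proj10 :: "('e::real_vector \<Rightarrow> 'e) \<Rightarrow> 'e \<Rightarrow> 'e \<times> 'e" where
  "proj10 J v = ((1/2) *\<^sub>R v, - ((1/2) *\<^sub>R J v))"

definition proj01 :: "('e::real_vector \<Rightarrow> 'e) \<Rightarrow> 'e \<Rightarrow> 'e \<times> 'e" where
  "proj01 J v = ((1/2) *\<^sub>R v, (1/2) *\<^sub>R J v)"

definition type_part ::
  "nat \<Rightarrow> nat \<Rightarrow> ('e::euclidean_space \<Rightarrow> 'e \<Rightarrow> 'e) \<Rightarrow> ('e, complex) local_form \<Rightarrow> ('e, complex) local_form"
where
  "type_part p q J w x v =
     (\<Sum>S | S \<subseteq> {..<p + q} \<and> card S = p.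
        cextend (p + q) (w x) (\<lambda>j. if j \<in> S then proj10 (J x) (v j) else proj01 (J x) (v j)))"

definition del ::
  "nat \<Rightarrow> ('e::euclidean_space \<Rightarrow> 'e \<Rightarrow> 'e) \<Rightarrow> ('e, complex) local_form \<Rightarrow> ('e, complex) local_form"
where
  "del k J w x v = (\<Sum>p\<le>k. type_part (Suc p) (k - p) J (ext_d k (type_part p (k - p) J w)) x v)"

definition delbar ::
  "nat \<Rightarrow> ('e::euclidean_space \<Rightarrow> 'e \<Rightarrow> 'e) \<Rightarrow> ('e, complex) local_form \<Rightarrow> ('e, complex) local_form"
where
  "delbar k J w x v = (\<Sum>p\<le>k. type_part p (Suc (k - p)) J (ext_d k (type_part p (k - p) J w)) x v)"

definition dc ::
  "nat \<Rightarrow> ('e::euclidean_space \<Rightarrow> 'e \<Rightarrow> 'e) \<Rightarrow> ('e, complex) local_form \<Rightarrow> ('e, complex) local_form"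
where
  "dc k J w x v = \<i> * (delbar k J w x v - del k J w x v)"


section \<open>Generalized Kaehler structures\<close>

text \<open>The form \<open>F(X, Y) = g(J X, Y)\<close>, regarded as a complex-valued 2-form.\<close>

definition fundamental_form ::
  "('e::euclidean_space \<Rightarrow> 'e \<Rightarrow> 'e \<Rightarrow> real) \<Rightarrow> ('e \<Rightarrow> 'e \<Rightarrow> 'e) \<Rightarrow> ('e, complex) local_form" where
  "fundamental_form g J x v = complex_of_real (g x (J x (v 0)) (v 1))"

definition hermitian_on ::
  "('a, 'e::euclidean_space) chart set \<Rightarrow> ('a, 'e) endo_field \<Rightarrow> ('a, 'e) metric_field \<Rightarrow> bool" where
  "hermitian_on A J g \<longleftrightarrow>
     (\<forall>c\<in>A. \<forall>x\<in>cimg c. \<forall>u v. g c x (J c x u) (J c x v) = g c x u v)"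

definition generalized_kaehler_on ::
  "'a::{t2_space,second_countable_topology} set \<Rightarrow> ('a, 'e::euclidean_space) chart set \<Rightarrow>
   ('a, 'e) endo_field \<Rightarrow> ('a, 'e) endo_field \<Rightarrow> ('a, 'e) metric_field \<Rightarrow> bool" where
  "generalized_kaehler_on M A Jp Jm g \<longleftrightarrow>
     smooth_atlas M A \<and> even DIM('e) \<and>
     complex_structure_on A Jp \<and> complex_structure_on A Jm \<and>
     riemannian_metric_on A g \<and> hermitian_on A Jp g \<and> hermitian_on A Jm g \<and>
     (\<forall>c\<in>A. \<forall>x\<in>cimg c. \<forall>v.
        dc 2 (Jp c) (fundamental_form (g c) (Jp c)) x v
        + dc 2 (Jm c) (fundamental_form (g c) (Jm c)) x v = 0 \<and>
        ext_d 3 (dc 2 (Jp c) (fundamental_form (g c) (Jp c))) x v = 0 \<and>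
        ext_d 3 (dc 2 (Jm c) (fundamental_form (g c) (Jm c))) x v = 0)"

definition nontrivial_pair ::
  "('a, 'e::euclidean_space) chart set \<Rightarrow> ('a, 'e) endo_field \<Rightarrow> ('a, 'e) endo_field \<Rightarrow> bool" where
  "nontrivial_pair A Jp Jm \<longleftrightarrow>
     \<not> (\<forall>c\<in>A. \<forall>x\<in>cimg c. \<forall>v. Jm c x v = Jp c x v) \<and>
     \<not> (\<forall>c\<in>A. \<forall>x\<in>cimg c. \<forall>v. Jm c x v = - Jp c x v)"


section \<open>Left-invariant fields and the Lie algebra\<close>

definition left_invariant_form ::
  "('a, 'm) monoid_scheme \<Rightarrow> ('a, 'e::euclidean_space) chart set \<Rightarrow> ('a, 'e, 'b) form_field \<Rightarrow> bool" where
  "left_invariant_form G A w \<longleftrightarrow> (\<forall>a\<in>carrier G. form_invariant A (\<lambda>p. a \<otimes>\<^bsub>G\<^esub> p) w)"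

definition left_invariant_endo ::
  "('a, 'm) monoid_scheme \<Rightarrow> ('a, 'e::euclidean_space) chart set \<Rightarrow> ('a, 'e) endo_field \<Rightarrow> bool" where
  "left_invariant_endo G A J \<longleftrightarrow> (\<forall>a\<in>carrier G. endo_invariant A (\<lambda>p. a \<otimes>\<^bsub>G\<^esub> p) J)"

definition left_invariant_metric ::
  "('a, 'm) monoid_scheme \<Rightarrow> ('a, 'e::euclidean_space) chart set \<Rightarrow> ('a, 'e) metric_field \<Rightarrow> bool" where
  "left_invariant_metric G A g \<longleftrightarrow> (\<forall>a\<in>carrier G. metric_invariant A (\<lambda>p. a \<otimes>\<^bsub>G\<^esub> p) g)"

text \<open>The dual of the Lie algebra is the space of left-invariant 1-forms, and its differential is
  the exterior derivative. Since that space has the dimension of the group, six linearly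
  independent left-invariant 1-forms on a 6-dimensional group form a basis of it.\<close>

definition has_lie_algebra_l ::
  "('a, 'm) monoid_scheme \<Rightarrow> ('a, real^6) chart set \<Rightarrow> bool" where
  "has_lie_algebra_l G A \<longleftrightarrow>
     (\<exists>f :: nat \<Rightarrow> ('a, real^6, real) form_field.
        (\<forall>j\<in>{1..6}. form_on A 1 (f j) \<and> left_invariant_form G A (f j)) \<and>
        (\<forall>r :: nat \<Rightarrow> real.
           (\<forall>c\<in>A. \<forall>x\<in>cimg c. \<forall>v. (\<Sum>j\<in>{1..6}. r j * f j c x v) = 0) \<longrightarrow> (\<forall>j\<in>{1..6}. r j = 0)) \<and>
        (\<forall>c\<in>A. \<forall>x\<in>cimg c. \<forall>v.
           ext_d 1 (f 1 c) x v = wedge1 (f 1 c) (f 2 c) x v \<and>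
           ext_d 1 (f 2 c) x v = 0 \<and>
           (\<forall>j\<in>{3,4,5,6}. ext_d 1 (f j c) x v = 1/2 * wedge1 (f 2 c) (f j c) x v)))"


section \<open>A model\<close>

text \<open>A simply connected Lie group with the Lie algebra in question exists: with weights \<open>a\<^sub>1 = 1\<close>,
  \<open>a\<^sub>2 = 0\<close> and \<open>a\<^sub>j = -1/2\<close> otherwise, take \<open>x y = (x\<^sub>i + exp (a\<^sub>i x\<^sub>2) y\<^sub>i)\<^sub>i\<close> on
  \<open>\<real>\<^sup>6\<close> and \<open>f\<^sup>i = exp (- a\<^sub>i x\<^sub>2) dx\<^sub>i\<close>. Nothing above depends on this section.\<close>

lemma Ck_const: "Ck_on k UNIV (\<lambda>x. c)"
  by (induction k arbitrary: c) auto

lemma Ck_add: "Ck_on k UNIV f \<Longrightarrow> Ck_on k UNIV g \<Longrightarrow> Ck_on k UNIV (\<lambda>x. f x + g x)"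
proof (induction k arbitrary: f g)
  case 0 then show ?case by (auto intro: continuous_intros)
next
  case (Suc k)
  have "frechet_derivative (\<lambda>x. f x + g x) (at x) = (\<lambda>v. frechet_derivative f (at x) v + frechet_derivative g (at x) v)" for x
    using Suc.prems
    by (intro frechet_derivative_at[symmetric] has_derivative_add) (auto simp: frechet_derivative_works[symmetric])
  then show ?case using Suc by (auto intro: differentiable_add)
qed

lemma Ck_linear: assumes "bounded_linear f" shows "Ck_on k UNIV f"
proof (cases k)
  case 0 then show ?thesis using assms by (auto intro: linear_continuous_on)
next
  case (Suc m)
  have "(f has_derivative f) (at x)" for x using assms by (rule bounded_linear_imp_has_derivative)
  then have "frechet_derivative f (at x) = f" "f differentiable (at x)" for x
    by (metis frechet_derivative_at, auto simp: differentiable_def)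
  then show ?thesis using Suc by (auto simp: Ck_const)
qed

lemma Ck_mono: "Ck_on (Suc k) UNIV f \<Longrightarrow> Ck_on k UNIV f"
proof (induction k arbitrary: f)
  case 0 then show ?case by (auto intro!: differentiable_imp_continuous_on simp: differentiable_on_def)
next
  case (Suc k)
  then show ?case by (metis Ck_on.simps(2))
qed

lemma Ck_mult:
  fixes f g :: "'e::euclidean_space \<Rightarrow> real"
  shows "Ck_on k UNIV f \<Longrightarrow> Ck_on k UNIV g \<Longrightarrow> Ck_on k UNIV (\<lambda>x. f x * g x)"
proof (induction k arbitrary: f g)
  case 0 then show ?case by (auto intro: continuous_intros)
next
  case (Suc k)
  have "frechet_derivative (\<lambda>x. f x * g x) (at x) = (\<lambda>v. f x * frechet_derivative g (at x) v + frechet_derivative f (at x) v * g x)" for x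
    using Suc.prems
    by (intro frechet_derivative_at[symmetric] has_derivative_mult) (auto simp: frechet_derivative_works[symmetric])
  moreover have "Ck_on k UNIV f" "Ck_on k UNIV g" using Suc.prems Ck_mono by blast+
  ultimately show ?case using Suc by (auto intro!: differentiable_mult Ck_add)
qed

lemma Ck_exp:
  fixes f :: "'e::euclidean_space \<Rightarrow> real"
  assumes "bounded_linear f"
  shows "Ck_on k UNIV (\<lambda>x. exp (f x))"
proof (induction k)
  case 0 then show ?case using linear_continuous_on[OF assms] by (auto intro!: continuous_intros simp del: )
next
  case (Suc k)
  have *: "((\<lambda>x. exp (f x)) has_derivative (\<lambda>v. f v * exp (f x))) (at x)" for x
    using has_derivative_exp[OF bounded_linear_imp_has_derivative[OF assms]] by (simp add: mult.commute)
  then have "frechet_derivative (\<lambda>x. exp (f x)) (at x) = (\<lambda>v. f v * exp (f x))"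
     "(\<lambda>x. exp (f x)) differentiable (at x)" for x
    by (metis frechet_derivative_at, auto simp: differentiable_def)
  then show ?case using Suc by (auto intro!: Ck_mult Ck_const)
qed

lemma Ck_scaleR:
  assumes "Ck_on k UNIV f" shows "Ck_on k UNIV (\<lambda>x. f x *\<^sub>R c)"
  using assms
proof (induction k arbitrary: f)
  case 0 then show ?case by (auto intro!: continuous_intros)
next
  case (Suc k)
  have *: "((\<lambda>x. f x *\<^sub>R c) has_derivative (\<lambda>v. frechet_derivative f (at x) v *\<^sub>R c)) (at x)" for x
    using Suc.prems
    by (intro has_derivative_scaleR_left) (auto simp: frechet_derivative_works[symmetric])
  then have "frechet_derivative (\<lambda>x. f x *\<^sub>R c) (at x) = (\<lambda>v. frechet_derivative f (at x) v *\<^sub>R c)"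
     "(\<lambda>x. f x *\<^sub>R c) differentiable (at x)" for x
    by (metis frechet_derivative_at, auto simp: differentiable_def)
  then show ?case using Suc by auto
qed

lemma Ck_sum: "finite I \<Longrightarrow> (\<And>i. i \<in> I \<Longrightarrow> Ck_on k UNIV (f i)) \<Longrightarrow> Ck_on k UNIV (\<lambda>x. \<Sum>i\<in>I. f i x)"
  by (induction I rule: finite_induct) (auto intro: Ck_const Ck_add)

lemma Ck_vec:
  fixes f :: "'e::euclidean_space \<Rightarrow> 'n::finite \<Rightarrow> real"
  assumes "\<And>i. Ck_on k UNIV (\<lambda>x. f x i)" shows "Ck_on k UNIV (\<lambda>x. \<chi> i. f x i)"
proof -
  have "(\<lambda>x. \<chi> i. f x i) = (\<lambda>x. \<Sum>i\<in>UNIV. f x i *\<^sub>R axis i 1)"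
    by (auto simp: vec_eq_iff fun_eq_iff axis_def if_distrib cong: if_cong)
  then show ?thesis using assms by (auto intro!: Ck_sum Ck_scaleR)
qed

definition weight :: "6 \<Rightarrow> real" where "weight i = (if i = 1 then 1 else if i = 2 then 0 else -1/2)"

definition model_mult :: "real^6 \<Rightarrow> real^6 \<Rightarrow> real^6" where
  "model_mult x y = (\<chi> i. x$i + exp (weight i * x$2) * y$i)"

definition model_group :: "(real^6) monoid" where
  "model_group = \<lparr>carrier = UNIV, mult = model_mult, one = 0\<rparr>"

definition model_inv :: "real^6 \<Rightarrow> real^6" where
  "model_inv x = (\<chi> i. - (exp (- weight i * x$2) * x$i))"

lemma weight_simps[simp]: "weight 2 = 0" "weight 1 = 1" by (auto simp: weight_def)
lemma model_mult_2[simp]: "model_mult x y $ 2 = x$2 + y$2" by (simp add: model_mult_def)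
lemma model_inv_mult: "model_mult (model_inv x) x = 0"
  by (auto simp: model_mult_def model_inv_def vec_eq_iff)

lemma model_group: "group model_group"
proof (rule groupI)
  fix x y z assume "x \<in> carrier model_group" "y \<in> carrier model_group" "z \<in> carrier model_group" 
  show "x \<otimes>\<^bsub>model_group\<^esub> y \<otimes>\<^bsub>model_group\<^esub> z = x \<otimes>\<^bsub>model_group\<^esub> (y \<otimes>\<^bsub>model_group\<^esub> z)"
    by (auto simp: model_group_def model_mult_def vec_eq_iff algebra_simps exp_add)
next
  fix x assume "x \<in> carrier model_group"
  show "\<one>\<^bsub>model_group\<^esub> \<otimes>\<^bsub>model_group\<^esub> x = x" by (simp add: model_group_def model_mult_def vec_eq_iff)
  show "\<exists>y\<in>carrier model_group. y \<otimes>\<^bsub>model_group\<^esub> x = \<one>\<^bsub>model_group\<^esub>"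
    by (auto simp: model_group_def intro: model_inv_mult)
qed (auto simp: model_group_def)

lemma model_group_inv: "inv\<^bsub>model_group\<^esub> x = model_inv x"
  by (rule group.inv_equality[OF model_group]) (auto simp: model_group_def model_inv_mult)

definition model_atlas :: "(real^6, real^6) chart set" where "model_atlas = {(UNIV, \<lambda>x. x)}"

lemma model_chart_simps[simp]: "cdom (UNIV, \<lambda>x. x) = UNIV" "cmap (UNIV, \<lambda>x. x) = (\<lambda>x. x)" "cimg (UNIV, \<lambda>x. x) = UNIV"
   "cinv (UNIV, \<lambda>x. x) = (\<lambda>x. x)"
  by (auto simp: cdom_def cmap_def cimg_def cinv_def fun_eq_iff inv_f_eq)

lemma model_prod_atlas: "prod_atlas model_atlas model_atlas = {(UNIV, \<lambda>x. x)}"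
  by (auto simp: prod_atlas_def model_atlas_def map_prod_def)

lemma smooth_id: "smooth_on UNIV (\<lambda>x. x)" by (auto simp: smooth_on_def intro: Ck_linear)

lemma smooth_cont: "smooth_on UNIV f \<Longrightarrow> continuous_on UNIV f"
  by (metis Ck_on.simps(1) smooth_on_def)

lemma smooth_model_mult: "smooth_on UNIV (\<lambda>(a, b). model_mult a b)"
  unfolding smooth_on_def model_mult_def case_prod_beta
  by (intro allI Ck_vec Ck_add Ck_mult Ck_exp Ck_linear)
    (auto intro!: bounded_linear_intros bounded_linear_mult_right[THEN bounded_linear_compose] bounded_linear_vec_nth[THEN bounded_linear_compose] bounded_linear_fst bounded_linear_snd)

lemma smooth_model_inv: "smooth_on UNIV model_inv"
proof -
  have *: "model_inv = (\<lambda>x. \<chi> i. (-1) * (exp (- weight i * x$2) * x$i))" by (auto simp: model_inv_def fun_eq_iff)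
  show ?thesis unfolding smooth_on_def *
  by (intro allI Ck_vec Ck_add Ck_mult Ck_exp Ck_linear Ck_const)
    (auto intro!: bounded_linear_intros bounded_linear_minus bounded_linear_mult_right[THEN bounded_linear_compose] bounded_linear_vec_nth[THEN bounded_linear_compose])
qed

lemma model_lie_group: "lie_group model_group model_atlas"
proof -
  have 1: "(\<lambda>a. inv\<^bsub>model_group\<^esub> a) = model_inv" by (auto simp: model_group_inv)
  have 2: "monoid.mult model_group = model_mult" "carrier model_group = UNIV" by (auto simp: model_group_def)
  show ?thesis
    using model_group smooth_model_mult smooth_model_inv smooth_cont[OF smooth_model_mult] smooth_cont[OF smooth_model_inv] smooth_id
    unfolding lie_group_def smooth_atlas_def smooth_map_def model_prod_atlas 1 2
    by (simp add: model_atlas_def local_rep_def o_def homeomorphism_def case_prod_beta')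
qed

definition model_form :: "nat \<Rightarrow> (real^6, real^6, real) form_field" where
  "model_form j c x v = exp (- weight (of_nat j) * x$2) * (v 0)$(of_nat j)"

lemma model_left_mult_derivative: "(model_mult a has_derivative (\<lambda>v. \<chi> i. exp (weight i * a$2) * v$i)) (at x)"
proof -
  have "bounded_linear (\<lambda>v::real^6. \<chi> i. exp (weight i * a$2) * v$i)"
    by (intro linear_conv_bounded_linear[THEN iffD1] linearI) (auto simp: vec_eq_iff algebra_simps)
  from has_derivative_add[OF has_derivative_const[of a] bounded_linear_imp_has_derivative[OF this]]
  have "((\<lambda>x. a + (\<chi> i. exp (weight i * a$2) * x$i)) has_derivative (\<lambda>v. \<chi> i. exp (weight i * a$2) * v$i)) (at x)"
    by simp
  moreover have "(\<lambda>x. a + (\<chi> i. exp (weight i * a$2) * x$i)) = model_mult a"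
    by (auto simp: model_mult_def vec_eq_iff fun_eq_iff)
  ultimately show ?thesis by simp
qed

lemma model_form_left_invariant: "left_invariant_form model_group model_atlas (model_form j)"
  unfolding left_invariant_form_def form_invariant_def
  by (auto simp: model_atlas_def model_group_def local_rep_def o_def frechet_derivative_at[OF model_left_mult_derivative, symmetric] model_form_def
     exp_add[symmetric] mult.assoc[symmetric] algebra_simps)

lemma model_form_form_on: "form_on model_atlas 1 (model_form j)"
  unfolding form_on_def form_invariant_def alternating_form_def
  apply (auto simp: model_atlas_def local_rep_def o_def id_def model_form_def smooth_on_def
     intro!: linearI algebra_simps)
    apply (auto simp: algebra_simps model_form_def)
  apply (intro Ck_mult Ck_const)
  apply (intro Ck_exp bounded_linear_minus bounded_linear_mult_right[THEN bounded_linear_compose] bounded_linear_vec_nth)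
  done

lemma model_form_ext_d: "ext_d 1 (model_form j c) x v = - weight (of_nat j) * wedge1 (model_form 2 c) (model_form j c) x v"
proof -
  have "((\<lambda>y. model_form j c y u) has_derivative (\<lambda>h. - weight (of_nat j) * h$2 * model_form j c x u)) (at x)" for u
    unfolding model_form_def
    by (auto intro!: derivative_eq_intros simp: bounded_linear_vec_nth bounded_linear_imp_has_derivative)
  from frechet_derivative_at[OF this, symmetric]
  have "frechet_derivative (\<lambda>y. model_form j c y u) (at x) = (\<lambda>h. - weight (of_nat j) * h$2 * model_form j c x u)" for u .
  then show ?thesis by (simp add: ext_d_def wedge1_def) (simp add: omit_def model_form_def algebra_simps)
qed

lemma model_form_independent: assumes "\<forall>c\<in>model_atlas. \<forall>x\<in>cimg c. \<forall>v. (\<Sum>j\<in>{1..6}. r j * model_form j c x v) = 0"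
  shows "\<forall>j\<in>{1..6::nat}. r j = 0"
proof -
  have S: "{1..6::nat} = {1,2,3,4,5,6}" by auto
  have "(\<Sum>j\<in>{1..6}. r j * (axis k 1 :: real^6)$(of_nat j)) = 0" for k
    using assms[unfolded model_atlas_def, simplified, rule_format, of 0 "\<lambda>_. axis k 1"] by (simp add: model_form_def)
  from this[of 1] this[of 2] this[of 3] this[of 4] this[of 5] this[of 6] show ?thesis
    unfolding S by (simp add: axis_def)
qed

theorem simply_connected_group_with_lie_algebra_l: "lie_group model_group model_atlas \<and> simply_connected (carrier model_group) \<and> has_lie_algebra_l model_group model_atlas"
proof (intro conjI)
  show "simply_connected (carrier model_group)" by (simp add: model_group_def convex_imp_simply_connected)
  show "has_lie_algebra_l model_group model_atlas" unfolding has_lie_algebra_l_def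
    apply (rule exI[of _ model_form]) using model_form_independent model_form_form_on model_form_left_invariant
    by (auto simp: model_form_ext_d[unfolded One_nat_def] weight_def wedge1_def)
qed (rule model_lie_group)

end

theory Submission
  imports Defs
begin

text \<open>Let \<open>e\<^sub>1, \<dots>, e\<^sub>6\<close> be the frame dual to \<open>f\<^sup>1, \<dots>, f\<^sup>6\<close>, let the \<open>e\<^sub>i\<close> be
  orthonormal for \<open>g\<close>, and for a sign \<open>s\<close> let \<open>J\<^sub>s\<close> map \<open>e\<^sub>1\<close> to \<open>s e\<^sub>2\<close>, \<open>e\<^sub>3\<close> to \<open>e\<^sub>4\<close> and
  \<open>e\<^sub>5\<close> to \<open>e\<^sub>6\<close>. It is integrable because \<open>ad e\<^sub>2\<close> acts on the span of \<open>e\<^sub>3, \<dots>, e\<^sub>6\<close> as a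
  scalar. The fundamental form \<open>s f\<^sup>1 \<and> f\<^sup>2 + f\<^sup>3 \<and> f\<^sup>4 + f\<^sup>5 \<and> f\<^sup>6\<close> has the differential
  \<open>f\<^sup>2 \<and> (f\<^sup>3 \<and> f\<^sup>4 + f\<^sup>5 \<and> f\<^sup>6)\<close>, so that \<open>d\<^sup>cF\<^sub>s = - s f\<^sup>1 \<and> (f\<^sup>3 \<and> f\<^sup>4 + f\<^sup>5 \<and> f\<^sup>6)\<close>.
  This form is closed, since the weights \<open>1, -1/2, -1/2\<close> add up to zero, and it changes sign
  with \<open>s\<close>. Hence \<open>(J\<^sub>1, J\<^sub>-\<^sub>1, g)\<close> is the required structure. The \<open>f\<^sup>i\<close> form a coframe at every
  point, because a linear relation at one point extends by left translations to the whole group.\<close>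

section \<open>Calculus of smooth functions on open sets\<close>

text \<open>Since \<open>S\<close> is open, the values on \<open>S\<close> determine the derivative
  at each of its points, so the functions can be exchanged at every order.\<close>

lemma Ck_on_cong:
  assumes "Ck_on k S f" and "\<And>x. x \<in> S \<Longrightarrow> f x = g x" and "open S"
  shows "Ck_on k S g"
  using assms(1,2)
proof (induction k arbitrary: f g)
  case 0
  then show ?case by (simp cong: continuous_on_cong)
next
  case (Suc k)
  have d: "f differentiable (at x)" if "x \<in> S" for x
    using Suc.prems that by simp
  have eq: "frechet_derivative f (at x) = frechet_derivative g (at x)" if "x \<in> S" for x
    using frechet_derivative_transform_within_open[OF d[OF that] \<open>open S\<close> that] Suc.prems(2) by blast
  have "(g has_derivative frechet_derivative f (at x)) (at x)" if "x \<in> S" for x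
    using has_derivative_transform_within_open[OF d[OF that, unfolded frechet_derivative_works]
        \<open>open S\<close> that Suc.prems(2)] .
  then have "\<forall>x\<in>S. g differentiable (at x)"
    using differentiable_def by blast
  moreover have "Ck_on k S (\<lambda>x. frechet_derivative g (at x) v)" for v
  proof (rule Suc.IH)
    show "Ck_on k S (\<lambda>x. frechet_derivative f (at x) v)" using Suc.prems(1) by simp
  qed (simp add: eq)
  ultimately show ?case by simp
qed

text \<open>Serves to work with an explicit derivative, which is known to equal
  \<open>frechet_derivative\<close> only on \<open>S\<close>.\<close>

lemma Ck_on_SucI:
  assumes "\<And>x. x \<in> S \<Longrightarrow> (f has_derivative f' x) (at x)"
    and "\<And>v. Ck_on k S (\<lambda>x. f' x v)"
    and "open S"
  shows "Ck_on (Suc k) S f"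
proof -
  have *: "frechet_derivative f (at x) = f' x" if "x \<in> S" for x
    using frechet_derivative_at[OF assms(1)[OF that]] by simp
  have "Ck_on k S (\<lambda>x. frechet_derivative f (at x) v)" for v
    by (rule Ck_on_cong[OF assms(2) _ assms(3)]) (simp add: *)
  moreover have "\<forall>x\<in>S. f differentiable (at x)"
    using assms(1) differentiable_def by blast
  ultimately show ?thesis by simp
qed

lemma Ck_on_has_derivative:
  "Ck_on (Suc k) S f \<Longrightarrow> x \<in> S \<Longrightarrow> (f has_derivative frechet_derivative f (at x)) (at x)"
  by (simp add: frechet_derivative_works)

lemma Ck_on_SucD: "Ck_on (Suc k) S f \<Longrightarrow> Ck_on k S f"
proof (induction k arbitrary: f)
  case 0
  then have "f differentiable_on S"
    by (simp add: differentiable_on_def differentiable_at_withinI)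
  then show ?case by (simp add: differentiable_imp_continuous_on)
next
  case (Suc k)
  note prems = Suc.prems[unfolded Ck_on.simps(2)[of "Suc k"]]
  have "Ck_on k S (\<lambda>x. frechet_derivative f (at x) v)" for v
    using prems by (blast intro: Suc.IH)
  then show ?case using prems by simp
qed

lemma Ck_on_const: "Ck_on k S (\<lambda>x. c)"
  by (induction k arbitrary: c) auto

lemma Ck_on_add:
  assumes "open S"
  shows "Ck_on k S f \<Longrightarrow> Ck_on k S g \<Longrightarrow> Ck_on k S (\<lambda>x. f x + g x)"
proof (induction k arbitrary: f g)
  case 0
  then show ?case by (auto intro: continuous_intros)
next
  case (Suc k)
  note der = Ck_on_has_derivative[OF Suc.prems(1)] Ck_on_has_derivative[OF Suc.prems(2)]
  show ?case
    using Suc by (intro Ck_on_SucI[OF has_derivative_add[OF der] _ assms]) auto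
qed

lemma (in bounded_bilinear) Ck_on_bilinear:
  assumes "open S"
  shows "Ck_on k S f \<Longrightarrow> Ck_on k S g \<Longrightarrow> Ck_on k S (\<lambda>x. prod (f x) (g x))"
proof (induction k arbitrary: f g)
  case 0
  then show ?case by (auto intro: continuous_on)
next
  case (Suc k)
  note der = Ck_on_has_derivative[OF Suc.prems(1)] Ck_on_has_derivative[OF Suc.prems(2)]
  show ?case
    using Suc Ck_on_SucD[OF Suc.prems(1)] Ck_on_SucD[OF Suc.prems(2)]
    by (intro Ck_on_SucI[OF FDERIV[OF der] _ assms] Ck_on_add[OF assms]) auto
qed

lemma Ck_on_linear_compose:
  assumes "open S" and "bounded_linear L"
  shows "Ck_on k S f \<Longrightarrow> Ck_on k S (\<lambda>x. L (f x))"
proof (induction k arbitrary: f)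
  case 0
  then show ?case using assms(2) by (auto intro: bounded_linear.continuous_on)
next
  case (Suc k)
  note der = Ck_on_has_derivative[OF Suc.prems]
  have "Ck_on k S (\<lambda>x. L (frechet_derivative f (at x) v))" for v
    using Suc.prems by (intro Suc.IH) simp
  then show ?case
    by (intro Ck_on_SucI[OF bounded_linear.has_derivative[OF assms(2) der] _ assms(1)])
qed

lemma Ck_on_inverse:
  fixes f :: "'e::euclidean_space \<Rightarrow> real"
  assumes "open S" and nz: "\<And>x. x \<in> S \<Longrightarrow> f x \<noteq> 0"
  shows "Ck_on k S f \<Longrightarrow> Ck_on k S (\<lambda>x. inverse (f x))"
proof (induction k)
  case 0
  then show ?case using nz by (auto intro: continuous_intros)
next
  case (Suc k)
  \<comment> \<open>The derivative contains \<open>inverse (f x)\<close> itself, which the induction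
    hypothesis covers.\<close>
  have der: "((\<lambda>x. inverse (f x)) has_derivative
      (\<lambda>v. (- 1) *\<^sub>R ((inverse (f x) * frechet_derivative f (at x) v) * inverse (f x)))) (at x)"
    if "x \<in> S" for x
    using Deriv.has_derivative_inverse[OF nz[OF that] Ck_on_has_derivative[OF Suc.prems that]] by simp
  note bl = bounded_bilinear.Ck_on_bilinear[OF bounded_bilinear_mult \<open>open S\<close>]
    bounded_bilinear.Ck_on_bilinear[OF bounded_bilinear_scaleR \<open>open S\<close>]
  have inv: "Ck_on k S (\<lambda>x. inverse (f x))"
    by (rule Suc.IH[OF Ck_on_SucD[OF Suc.prems]])
  have "Ck_on k S (\<lambda>x. frechet_derivative f (at x) v)" for v
    using Suc.prems by simp
  then show ?case
    by (intro Ck_on_SucI[OF der _ \<open>open S\<close>] bl Ck_on_const inv)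
qed

lemma smooth_on_has_derivative:
  "smooth_on S f \<Longrightarrow> x \<in> S \<Longrightarrow> (f has_derivative frechet_derivative f (at x)) (at x)"
  using Ck_on_has_derivative unfolding smooth_on_def by blast

lemma smooth_on_cong:
  "smooth_on S f \<Longrightarrow> (\<And>x. x \<in> S \<Longrightarrow> f x = g x) \<Longrightarrow> open S \<Longrightarrow> smooth_on S g"
  unfolding smooth_on_def using Ck_on_cong by blast

lemma smooth_on_const: "smooth_on S (\<lambda>x. c)"
  by (simp add: smooth_on_def Ck_on_const)

lemma smooth_on_add:
  "open S \<Longrightarrow> smooth_on S f \<Longrightarrow> smooth_on S g \<Longrightarrow> smooth_on S (\<lambda>x. f x + g x)"
  by (simp add: smooth_on_def Ck_on_add)

lemma (in bounded_bilinear) smooth_on_bilinear: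
  "open S \<Longrightarrow> smooth_on S f \<Longrightarrow> smooth_on S g \<Longrightarrow> smooth_on S (\<lambda>x. prod (f x) (g x))"
  by (simp add: smooth_on_def Ck_on_bilinear)

lemmas smooth_on_mult = bounded_bilinear.smooth_on_bilinear[OF bounded_bilinear_mult]
lemmas smooth_on_scaleR = bounded_bilinear.smooth_on_bilinear[OF bounded_bilinear_scaleR]
lemmas smooth_on_inner = bounded_bilinear.smooth_on_bilinear[OF bounded_bilinear_inner]

lemma smooth_on_linear_compose:
  "open S \<Longrightarrow> bounded_linear L \<Longrightarrow> smooth_on S f \<Longrightarrow> smooth_on S (\<lambda>x. L (f x))"
  by (simp add: smooth_on_def Ck_on_linear_compose)

lemma smooth_on_divide:
  fixes f g :: "'e::euclidean_space \<Rightarrow> real"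
  assumes "open S" "smooth_on S f" "smooth_on S g" "\<And>x. x \<in> S \<Longrightarrow> g x \<noteq> 0"
  shows "smooth_on S (\<lambda>x. f x / g x)"
proof -
  have "smooth_on S (\<lambda>x. inverse (g x))"
    using assms by (simp add: smooth_on_def Ck_on_inverse)
  then show ?thesis
    using smooth_on_mult[OF assms(1,2)] by (simp add: divide_inverse)
qed

lemma smooth_on_sum:
  "open S \<Longrightarrow> (\<And>i. i \<in> I \<Longrightarrow> smooth_on S (f i)) \<Longrightarrow> smooth_on S (\<lambda>x. \<Sum>i\<in>I. f i x)"
  by (induction I rule: infinite_finite_induct) (auto intro: smooth_on_const smooth_on_add)

lemma smooth_on_prod:
  fixes f :: "'i \<Rightarrow> 'e::euclidean_space \<Rightarrow> real"
  shows "open S \<Longrightarrow> (\<And>i. i \<in> I \<Longrightarrow> smooth_on S (f i)) \<Longrightarrow> smooth_on S (\<lambda>x. \<Prod>i\<in>I. f i x)"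
  by (induction I rule: infinite_finite_induct) (auto intro: smooth_on_const smooth_on_mult)

lemma smooth_on_vec:
  fixes f :: "'e::euclidean_space \<Rightarrow> 'n::finite \<Rightarrow> real"
  assumes "open S" "\<And>i. smooth_on S (\<lambda>x. f x i)"
  shows "smooth_on S (\<lambda>x. \<chi> i. f x i)"
proof -
  have "(\<lambda>x. \<chi> i. f x i) = (\<lambda>x. \<Sum>i\<in>UNIV. f x i *\<^sub>R axis i 1)"
    by (auto simp: vec_eq_iff fun_eq_iff axis_def if_distrib cong: if_cong)
  then show ?thesis
    using assms by (auto intro!: smooth_on_sum smooth_on_scaleR smooth_on_const)
qed

lemma smooth_on_vec_nth: "open S \<Longrightarrow> smooth_on S f \<Longrightarrow> smooth_on S (\<lambda>x. f x $ i)"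
  by (rule smooth_on_linear_compose[OF _ bounded_linear_vec_nth])

lemma smooth_on_det:
  fixes M :: "'e::euclidean_space \<Rightarrow> real^'n^'n"
  assumes "open S" "\<And>i j. smooth_on S (\<lambda>x. M x $ i $ j)"
  shows "smooth_on S (\<lambda>x. det (M x))"
  unfolding det_def using assms
  by (auto intro!: smooth_on_sum smooth_on_mult smooth_on_const smooth_on_prod)

section \<open>Linear maps depending smoothly on a point\<close>

lemma linear_euclidean_expansion:
  fixes L :: "'f::euclidean_space \<Rightarrow> 'g::real_vector"
  assumes "linear L"
  shows "L v = (\<Sum>b\<in>Basis. (v \<bullet> b) *\<^sub>R L b)"
proof -
  have "L v = L (\<Sum>b\<in>Basis. (v \<bullet> b) *\<^sub>R b)"
    by (simp only: euclidean_representation)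
  then show ?thesis
    by (simp only: linear_sum[OF assms] linear_scale[OF assms])
qed

lemma smooth_on_linear_family:
  fixes \<phi> :: "'e::euclidean_space \<Rightarrow> 'f::euclidean_space \<Rightarrow> 'g::euclidean_space"
  assumes "open S" "\<And>x. linear (\<phi> x)" "\<And>v. smooth_on S (\<lambda>x. \<phi> x v)" "smooth_on S Y"
  shows "smooth_on S (\<lambda>x. \<phi> x (Y x))"
proof -
  have "smooth_on S (\<lambda>x. \<Sum>b\<in>Basis. (Y x \<bullet> b) *\<^sub>R \<phi> x b)"
    using assms by (intro smooth_on_sum smooth_on_scaleR smooth_on_inner smooth_on_const)
  then show ?thesis
    by (simp only: linear_euclidean_expansion[OF assms(2), symmetric])
qed

lemma has_derivative_linear_family:
  fixes \<phi> :: "'e::euclidean_space \<Rightarrow> 'f::euclidean_space \<Rightarrow> 'g::euclidean_space"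
  assumes lin: "\<And>y. linear (\<phi> y)"
    and \<phi>: "\<And>v. ((\<lambda>y. \<phi> y v) has_derivative D v) (at x)"
    and Y: "(Y has_derivative Y') (at x)"
  shows "((\<lambda>y. \<phi> y (Y y)) has_derivative (\<lambda>u. D (Y x) u + \<phi> x (Y' u))) (at x)"
proof -
  \<comment> \<open>Linearity of \<open>D v\<close> in \<open>v\<close> follows from that of \<phi>
    by uniqueness of derivatives.\<close>
  have "((\<lambda>y. \<Sum>b\<in>Basis. (v \<bullet> b) *\<^sub>R \<phi> y b) has_derivative
      (\<lambda>u. \<Sum>b\<in>Basis. (v \<bullet> b) *\<^sub>R D b u)) (at x)" for v
    by (intro has_derivative_sum has_derivative_scaleR_right \<phi>)
  then have "D v = (\<lambda>u. \<Sum>b\<in>Basis. (v \<bullet> b) *\<^sub>R D b u)" for v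
    using has_derivative_unique \<phi> by (simp only: linear_euclidean_expansion[OF lin, symmetric]) blast
  then have D: "D v u = (\<Sum>b\<in>Basis. (v \<bullet> b) *\<^sub>R D b u)" for v u
    by (rule fun_cong)
  have "((\<lambda>y. \<Sum>b\<in>Basis. (Y y \<bullet> b) *\<^sub>R \<phi> y b) has_derivative
      (\<lambda>u. \<Sum>b\<in>Basis. (Y x \<bullet> b) *\<^sub>R D b u + (Y' u \<bullet> b) *\<^sub>R \<phi> x b)) (at x)"
    by (intro has_derivative_sum has_derivative_scaleR has_derivative_inner_left Y \<phi>)
  then show ?thesis
    by (simp only: linear_euclidean_expansion[OF lin, symmetric] sum.distrib D[of "Y x", symmetric])
qed

text \<open>By Cramer's rule the components of the preimage are quotients of polynomials in the
  matrix entries; injectivity makes the denominator nonzero.\<close>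

lemma smooth_on_inverse_linear_family:
  fixes \<phi> :: "real^'n \<Rightarrow> real^'n \<Rightarrow> real^'n"
  assumes "open S" and lin: "\<And>x. linear (\<phi> x)" and inj: "\<And>x. inj (\<phi> x)"
    and smooth: "\<And>v. smooth_on S (\<lambda>x. \<phi> x v)"
  shows "smooth_on S (\<lambda>x. inv_into UNIV (\<phi> x) b)"
proof -
  have nz: "det (matrix (\<phi> x)) \<noteq> 0" for x
    using det_nz_iff_inj[OF lin] inj by blast
  have "inv_into UNIV (\<phi> x) b = (\<chi> k. det (\<chi> i j. if j = k then b$i else matrix (\<phi> x)$i$j) / det (matrix (\<phi> x)))"
    for x
  proof -
    have "matrix (\<phi> x) *v inv_into UNIV (\<phi> x) b = b"
      using linear_injective_imp_surjective[OF lin inj]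
      by (simp add: matrix_vector_mul(2)[OF lin] surj_f_inv_f)
    then show ?thesis using cramer[OF nz] by blast
  qed
  moreover have M: "smooth_on S (\<lambda>x. matrix (\<phi> x) $ i $ j)" for i j
    unfolding matrix_def using smooth_on_vec_nth[OF \<open>open S\<close> smooth] by simp
  then have "smooth_on S (\<lambda>x. (\<chi> i j. if j = k then b$i else matrix (\<phi> x)$i$j) $ i $ j)" for k i j
    by (cases "j = k") (simp_all add: smooth_on_const)
  ultimately show ?thesis
    using M nz \<open>open S\<close>
    by (simp only:) (intro smooth_on_vec smooth_on_divide smooth_on_det; simp)
qed


section \<open>The model structures on the Lie algebra\<close>

lemma UNIV_6: "(UNIV :: 6 set) = {1, 2, 3, 4, 5, 6}"
proof -
  have "i \<in> {1, 2, 3, 4, 5, 6}" for i :: 6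
  proof (induct i)
    case (of_int z)
    then have "0 \<le> z" "z < 6" by simp_all
    \<comment> \<open>The residue 0 is the element listed as \<open>6\<close>.\<close>
    then have "z = 0 \<or> z = 1 \<or> z = 2 \<or> z = 3 \<or> z = 4 \<or> z = 5" by arith
    then show ?case by auto
  qed
  then show ?thesis by blast
qed

lemma sum_6: "sum f (UNIV :: 6 set) = f 1 + f 2 + f 3 + f 4 + f 5 + f 6"
  unfolding UNIV_6 by (simp add: add.assoc)

lemma vec_eq_iff_6:
  fixes u v :: "'a^6"
  shows "u = v \<longleftrightarrow> u$1 = v$1 \<and> u$2 = v$2 \<and> u$3 = v$3 \<and> u$4 = v$4 \<and> u$5 = v$5 \<and> u$6 = v$6"
proof -
  have "u = v \<longleftrightarrow> (\<forall>i\<in>UNIV. u$i = v$i)" by (simp add: vec_eq_iff)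
  then show ?thesis unfolding UNIV_6 by simp
qed

text \<open>The structure \<open>J\<^sub>s\<close> in frame coordinates; the last branch is the
  index 6. A real parameter \<open>s\<close> with \<open>s^2 = 1\<close> treats both signs at
  once.\<close>

definition std_J :: "real \<Rightarrow> real^6 \<Rightarrow> real^6" where
  "std_J s v = (\<chi> i. if i = 1 then - s * v$2 else if i = 2 then s * v$1
     else if i = 3 then - v$4 else if i = 4 then v$3 else if i = 5 then - v$6 else v$5)"

lemma std_J_nth [simp]:
  "std_J s v $ 1 = - s * v$2" "std_J s v $ 2 = s * v$1" "std_J s v $ 3 = - v$4"
  "std_J s v $ 4 = v$3" "std_J s v $ 5 = - v$6" "std_J s v $ 6 = v$5"
  by (simp_all add: std_J_def)

lemma linear_std_J: "linear (std_J s)"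
  by (rule linearI) (simp_all add: vec_eq_iff_6 algebra_simps)

lemma bounded_linear_std_J: "bounded_linear (std_J s)"
  using linear_std_J by (simp add: linear_conv_bounded_linear)

lemmas std_J_linear_simps =
  linear_add[OF linear_std_J] linear_diff[OF linear_std_J] linear_neg[OF linear_std_J]
  linear_scale[OF linear_std_J] linear_0[OF linear_std_J]

lemma std_J_square: "s^2 = 1 \<Longrightarrow> std_J s (std_J s v) = - v"
  by (auto simp: vec_eq_iff_6 power2_eq_1_iff)

lemma std_J_orthogonal: "s^2 = 1 \<Longrightarrow> std_J s u \<bullet> std_J s v = u \<bullet> v"
  by (auto simp: inner_vec_def sum_6 power2_eq_1_iff)

lemma std_J_skew: "std_J s u \<bullet> v = - (u \<bullet> std_J s v)"
  by (simp add: inner_vec_def sum_6 algebra_simps)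

text \<open>With \<open>f = (f\<^sup>1, \<dots>, f\<^sup>6)\<close> the structure equations read \<open>df(u, v) = struct (f u) (f v)\<close>.\<close>

definition struct :: "real^6 \<Rightarrow> real^6 \<Rightarrow> real^6" where
  "struct p q = (\<chi> i. weight i * (p$i * q$2 - p$2 * q$i))"

lemma struct_nth [simp]:
  "struct p q $ 1 = p$1 * q$2 - p$2 * q$1" "struct p q $ 2 = 0"
  "struct p q $ 3 = (p$2 * q$3 - p$3 * q$2) / 2" "struct p q $ 4 = (p$2 * q$4 - p$4 * q$2) / 2"
  "struct p q $ 5 = (p$2 * q$5 - p$5 * q$2) / 2" "struct p q $ 6 = (p$2 * q$6 - p$6 * q$2) / 2"
  by (simp_all add: struct_def weight_def field_simps)

text \<open>This is the vanishing of the Nijenhuis tensor on left-invariant fields, since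
  \<open>struct\<close> is minus their bracket read in the frame.\<close>

lemma struct_std_J:
  assumes "s^2 = 1"
  shows "struct (std_J s p) (std_J s q) - struct p q
    = std_J s (struct (std_J s p) q) + std_J s (struct p (std_J s q))"
  using assms by (auto simp: vec_eq_iff_6 power2_eq_1_iff) (simp_all add: field_simps)

text \<open>The 3-form \<open>f\<^sup>i \<and> (f\<^sup>3 \<and> f\<^sup>4 + f\<^sup>5 \<and>
  f\<^sup>6)\<close>. For \<open>i = 2\<close> it is the differential of the fundamental form, for
  \<open>i = 1\<close> the torsion up to the factor \<open>- s\<close>.\<close>

definition wedge_34_56 :: "6 \<Rightarrow> real^6 \<Rightarrow> real^6 \<Rightarrow> real^6 \<Rightarrow> real" where
  "wedge_34_56 i p q r =
     p$i * (q$3 * r$4 - q$4 * r$3 + q$5 * r$6 - q$6 * r$5)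
     - q$i * (p$3 * r$4 - p$4 * r$3 + p$5 * r$6 - p$6 * r$5)
     + r$i * (p$3 * q$4 - p$4 * q$3 + p$5 * q$6 - p$6 * q$5)"

lemma wedge_34_56_linear: "linear (\<lambda>p. wedge_34_56 i p q r)"
  by (rule linearI) (simp_all add: wedge_34_56_def algebra_simps)

text \<open>The differential of \<open>(\<lambda>p q. std_J s p \<bullet> q) = s f\<^sup>1\<^sup>2 + f\<^sup>3\<^sup>4 + f\<^sup>5\<^sup>6\<close>.\<close>

lemma struct_fundamental:
  "std_J s (struct p q) \<bullet> r - std_J s (struct p r) \<bullet> q + std_J s (struct q r) \<bullet> p
    = wedge_34_56 2 p q r"
  by (simp add: inner_vec_def sum_6 wedge_34_56_def field_simps)

text \<open>Closedness of the form with \<open>i = 1\<close>: the contribution of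
  \<open>df\<^sup>1 = f\<^sup>1 \<and> f\<^sup>2\<close> cancels that of \<open>d(f\<^sup>3 \<and>
  f\<^sup>4) = f\<^sup>2 \<and> f\<^sup>3 \<and> f\<^sup>4\<close>, and likewise for 5 and
  6.\<close>

lemma struct_torsion:
  "wedge_34_56 1 (struct p q) r t - wedge_34_56 1 (struct p r) q t + wedge_34_56 1 (struct p t) q r
    + wedge_34_56 1 (struct q r) p t - wedge_34_56 1 (struct q t) p r + wedge_34_56 1 (struct r t) p q = 0"
  by (simp add: wedge_34_56_def field_simps)

text \<open>For a \<open>3\<close>-form \<open>T\<close> the left hand side is, up to the factor \<open>-1/4\<close>,
  \<open>\<i> (T\<^sup>1\<^sup>,\<^sup>2 - T\<^sup>2\<^sup>,\<^sup>1)\<close>.\<close>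

lemma wedge_34_56_std_J:
  assumes "s^2 = 1"
  shows "3 * wedge_34_56 2 (std_J s p) (std_J s q) (std_J s r) + wedge_34_56 2 (std_J s p) q r
      + wedge_34_56 2 p (std_J s q) r + wedge_34_56 2 p q (std_J s r)
    = 4 * s * wedge_34_56 1 p q r"
  using assms by (auto simp: wedge_34_56_def power2_eq_1_iff algebra_simps)


section \<open>Types of forms\<close>

lemma Pow_lessThan_2: "Pow {..<2::nat} = {{}, {0}, {1}, {0, 1}}"
  by (simp add: numeral_2_eq_2 lessThan_Suc Pow_insert) auto

lemma Pow_lessThan_3: "Pow {..<3::nat} = {{}, {0}, {1}, {2}, {0, 1}, {0, 2}, {1, 2}, {0, 1, 2}}"
  by (simp add: numeral_3_eq_3 numeral_2_eq_2 lessThan_Suc Pow_insert) auto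

lemma subsets_lessThan_2:
  "{S. S \<subseteq> {..<2::nat} \<and> card S = 0} = {{}}"
  "{S. S \<subseteq> {..<2::nat} \<and> card S = 1} = {{0}, {1}}"
  "{S. S \<subseteq> {..<2::nat} \<and> card S = 2} = {{0, 1}}"
proof -
  have "{S. S \<subseteq> {..<2::nat} \<and> P S} = {S \<in> Pow {..<2}. P S}" for P by blast
  then have *: "{S. S \<subseteq> {..<2::nat} \<and> P S} = {S \<in> {{}, {0}, {1}, {0, 1}}. P S}" for P
    unfolding Pow_lessThan_2 .
  show "{S. S \<subseteq> {..<2::nat} \<and> card S = 0} = {{}}"
    "{S. S \<subseteq> {..<2::nat} \<and> card S = 1} = {{0}, {1}}"
    "{S. S \<subseteq> {..<2::nat} \<and> card S = 2} = {{0, 1}}"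
    unfolding * by auto
qed

lemma subsets_lessThan_3:
  "{S. S \<subseteq> {..<3::nat} \<and> card S = 1} = {{0}, {1}, {2}}"
  "{S. S \<subseteq> {..<3::nat} \<and> card S = 2} = {{0, 1}, {0, 2}, {1, 2}}"
proof -
  have "{S. S \<subseteq> {..<3::nat} \<and> P S} = {S \<in> Pow {..<3}. P S}" for P by blast
  then have *: "{S. S \<subseteq> {..<3::nat} \<and> P S}
      = {S \<in> {{}, {0}, {1}, {2}, {0, 1}, {0, 2}, {1, 2}, {0, 1, 2}}. P S}" for P
    unfolding Pow_lessThan_3 .
  show "{S. S \<subseteq> {..<3::nat} \<and> card S = 1} = {{0}, {1}, {2}}"
    "{S. S \<subseteq> {..<3::nat} \<and> card S = 2} = {{0, 1}, {0, 2}, {1, 2}}"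
    unfolding * by auto
qed

text \<open>Repeated use unrolls the sum in \<open>cextend\<close> into one term per choice of real
  or imaginary part in each slot.\<close>

lemma sum_Pow_insert:
  assumes "finite A" "a \<notin> A"
  shows "sum f (Pow (insert a A)) = sum f (Pow A) + (\<Sum>S\<in>Pow A. f (insert a S))"
proof -
  have "inj_on (insert a) (Pow A)"
    using assms(2) by (auto intro!: inj_onI)
  moreover have "Pow A \<inter> insert a ` Pow A = {}"
    using assms(2) by auto
  ultimately show ?thesis
    using assms(1) by (simp add: Pow_insert sum.union_disjoint sum.reindex)
qed

lemma cextend_2:
  fixes T :: "'e::real_vector \<Rightarrow> 'e \<Rightarrow> real"
  assumes "\<And>v. w v = complex_of_real (T (v 0) (v 1))"
  shows "cextend 2 w z = complex_of_real (T (fst (z 0)) (fst (z 1)) - T (snd (z 0)) (snd (z 1)))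
    + \<i> * complex_of_real (T (snd (z 0)) (fst (z 1)) + T (fst (z 0)) (snd (z 1)))"
proof -
  have "{..<2::nat} = {0, 1}" by auto
  then show ?thesis
    by (simp add: cextend_def assms sum_Pow_insert algebra_simps)
qed

lemma cextend_3:
  fixes T :: "'e::real_vector \<Rightarrow> 'e \<Rightarrow> 'e \<Rightarrow> real"
  assumes "\<And>v. w v = complex_of_real (T (v 0) (v 1) (v 2))"
  shows "cextend 3 w z = complex_of_real
      (T (fst (z 0)) (fst (z 1)) (fst (z 2)) - T (snd (z 0)) (snd (z 1)) (fst (z 2))
       - T (snd (z 0)) (fst (z 1)) (snd (z 2)) - T (fst (z 0)) (snd (z 1)) (snd (z 2)))
    + \<i> * complex_of_real
      (T (snd (z 0)) (fst (z 1)) (fst (z 2)) + T (fst (z 0)) (snd (z 1)) (fst (z 2))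
       + T (fst (z 0)) (fst (z 1)) (snd (z 2)) - T (snd (z 0)) (snd (z 1)) (snd (z 2)))"
proof -
  have "{..<3::nat} = {0, 1, 2}" by auto
  then show ?thesis
    by (simp add: cextend_def assms sum_Pow_insert algebra_simps)
qed

text \<open>The two projections contribute 1/4. For type (1, 1) both choices of the (1, 0) slot
  occur; their mixed terms cancel and the others double.\<close>

lemma type_part_2:
  fixes T :: "'e::euclidean_space \<Rightarrow> 'e \<Rightarrow> real"
  assumes w: "\<And>v. w x v = complex_of_real (T (v 0) (v 1))" and T: "bilinear T"
  shows "4 * type_part 2 0 J w x v = complex_of_real (T (v 0) (v 1) - T (J x (v 0)) (J x (v 1)))
      - \<i> * complex_of_real (T (J x (v 0)) (v 1) + T (v 0) (J x (v 1)))"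
    and "4 * type_part 0 2 J w x v = complex_of_real (T (v 0) (v 1) - T (J x (v 0)) (J x (v 1)))
      + \<i> * complex_of_real (T (J x (v 0)) (v 1) + T (v 0) (J x (v 1)))"
    and "2 * type_part 1 1 J w x v = complex_of_real (T (v 0) (v 1) + T (J x (v 0)) (J x (v 1)))"
proof -
  note lin = bilinear_lmul[OF T] bilinear_rmul[OF T] bilinear_lneg[OF T] bilinear_rneg[OF T]
  have two: "(2::nat) + 0 = 2" "(0::nat) + 2 = 2" "(1::nat) + 1 = 2" by simp_all
  show "4 * type_part 2 0 J w x v = complex_of_real (T (v 0) (v 1) - T (J x (v 0)) (J x (v 1)))
      - \<i> * complex_of_real (T (J x (v 0)) (v 1) + T (v 0) (J x (v 1)))"
    "4 * type_part 0 2 J w x v = complex_of_real (T (v 0) (v 1) - T (J x (v 0)) (J x (v 1)))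
      + \<i> * complex_of_real (T (J x (v 0)) (v 1) + T (v 0) (J x (v 1)))"
    "2 * type_part 1 1 J w x v = complex_of_real (T (v 0) (v 1) + T (J x (v 0)) (J x (v 1)))"
    unfolding type_part_def two subsets_lessThan_2 cextend_2[of "w x" T, OF w]
    by (simp_all add: proj10_def proj01_def lin algebra_simps)
qed

text \<open>As \<open>T\<close> is real, the two types are conjugate, so only terms with an odd
  number of \<open>J\<close> survive. Over the three choices of slots the signs of a single
  \<open>J\<close> add up to 1, while the triple term is counted three times. The 1/8 of the
  projections doubles in the difference.\<close>

lemma type_part_3:
  fixes T :: "'e::euclidean_space \<Rightarrow> 'e \<Rightarrow> 'e \<Rightarrow> real"
  assumes w: "\<And>v. w x v = complex_of_real (T (v 0) (v 1) (v 2))"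
    and lin: "\<And>q r. linear (\<lambda>p. T p q r)" "\<And>p r. linear (\<lambda>q. T p q r)" "\<And>p q. linear (\<lambda>r. T p q r)"
  shows "\<i> * (type_part 1 2 J w x v - type_part 2 1 J w x v) = complex_of_real (- (1/4) *
    (3 * T (J x (v 0)) (J x (v 1)) (J x (v 2)) + T (J x (v 0)) (v 1) (v 2)
      + T (v 0) (J x (v 1)) (v 2) + T (v 0) (v 1) (J x (v 2))))"
proof -
  have *: "sum f {{0}, {1}, {2}} = f {0} + f {1} + f {2}"
    "sum f {{0, 1}, {0, 2}, {1, 2}} = f {0, 1} + f {0, 2} + f {1, 2}"
    for f :: "nat set \<Rightarrow> complex"
    by (simp_all add: doubleton_eq_iff add.assoc)
  have three: "(1::nat) + 2 = 3" "(2::nat) + 1 = 3" by simp_all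
  show ?thesis
    unfolding type_part_def three subsets_lessThan_3 * cextend_3[of "w x" T, OF w]
    by (simp add: proj10_def proj01_def lin[THEN linear_scale] lin[THEN linear_neg] complex_eq_iff
        algebra_simps)
qed


section \<open>Structures defined by a coframe\<close>

text \<open>A coframe at \<open>x\<close> is encoded as a linear map \<open>\<phi> x\<close> to
  \<open>real^6\<close>, along which the model structure is pulled back.\<close>

definition frame_J :: "real \<Rightarrow> ('p \<Rightarrow> real^6 \<Rightarrow> real^6) \<Rightarrow> 'p \<Rightarrow> real^6 \<Rightarrow> real^6" where
  "frame_J s \<phi> x v = inv_into UNIV (\<phi> x) (std_J s (\<phi> x v))"

definition frame_metric :: "('p \<Rightarrow> real^6 \<Rightarrow> real^6) \<Rightarrow> 'p \<Rightarrow> real^6 \<Rightarrow> real^6 \<Rightarrow> real" where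
  "frame_metric \<phi> x u v = \<phi> x u \<bullet> \<phi> x v"

lemma wedge_34_56_has_derivative:
  assumes "(P has_derivative P') (at x)" "(Q has_derivative Q') (at x)" "(R has_derivative R') (at x)"
  shows "((\<lambda>y. wedge_34_56 i (P y) (Q y) (R y)) has_derivative
    (\<lambda>u. wedge_34_56 i (P' u) (Q x) (R x) + wedge_34_56 i (P x) (Q' u) (R x)
      + wedge_34_56 i (P x) (Q x) (R' u))) (at x)"
proof -
  note nth = assms[THEN bounded_linear.has_derivative[OF bounded_linear_vec_nth]]
  show ?thesis
    unfolding wedge_34_56_def
    by (rule derivative_eq_intros nth refl | simp add: algebra_simps)+
qed

lemma type_part_zero: "type_part p q J (\<lambda>_ _. 0) = (\<lambda>_ _. 0)"
  by (simp add: type_part_def cextend_def fun_eq_iff)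

lemma ext_d_zero: "ext_d k (\<lambda>_ _. 0) = (\<lambda>_ _. 0)"
  by (simp add: ext_d_def fun_eq_iff)

text \<open>For a form of type (1, 1) only the summand \<open>p = 1\<close> survives in
  \<open>del\<close> and \<open>delbar\<close>.\<close>

lemma dc_2:
  assumes "type_part 2 0 J w = (\<lambda>_ _. 0)" "type_part 1 1 J w = w" "type_part 0 2 J w = (\<lambda>_ _. 0)"
  shows "dc 2 J w x v = \<i> * (type_part 1 2 J (ext_d 2 w) x v - type_part 2 1 J (ext_d 2 w) x v)"
proof -
  have "(\<Sum>p\<le>2. f p (2 - p) (Suc p) (Suc (2 - p))) = f 0 2 1 3 + f 1 1 2 2 + f 2 0 3 1"
    for f :: "nat \<Rightarrow> nat \<Rightarrow> nat \<Rightarrow> nat \<Rightarrow> complex"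
    by (simp add: numeral_2_eq_2 numeral_3_eq_3)
  note sums = this[of "\<lambda>p q p' q'. type_part p' q J (ext_d 2 (type_part p q J w)) x v"]
    this[of "\<lambda>p q p' q'. type_part p q' J (ext_d 2 (type_part p q J w)) x v"]
  show ?thesis
    unfolding dc_def del_def delbar_def sums assms ext_d_zero type_part_zero by simp
qed

lemma ext_d_2:
  "ext_d 2 w x v = frechet_derivative (\<lambda>y. w y (omit 0 v)) (at x) (v 0)
    - frechet_derivative (\<lambda>y. w y (omit 1 v)) (at x) (v 1)
    + frechet_derivative (\<lambda>y. w y (omit 2 v)) (at x) (v 2)"
proof -
  have "{..2::nat} = {0, 1, 2}" by auto
  then show ?thesis by (simp add: ext_d_def)
qed

lemma ext_d_3:
  "ext_d 3 w x v = frechet_derivative (\<lambda>y. w y (omit 0 v)) (at x) (v 0)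
    - frechet_derivative (\<lambda>y. w y (omit 1 v)) (at x) (v 1)
    + frechet_derivative (\<lambda>y. w y (omit 2 v)) (at x) (v 2)
    - frechet_derivative (\<lambda>y. w y (omit 3 v)) (at x) (v 3)"
proof -
  have "{..3::nat} = {0, 1, 2, 3}" by auto
  then show ?thesis by (simp add: ext_d_def)
qed

text \<open>The situation in one chart. Linearity and injectivity are global in \<open>x\<close>, as
  the lemmas on linear families require. The left side of \<open>structure_eq\<close> is the
  exterior derivative on the constant fields \<open>u\<close> and \<open>v\<close>.\<close>

locale coframe =
  fixes S :: "(real^6) set" and \<phi> :: "real^6 \<Rightarrow> real^6 \<Rightarrow> real^6"
  assumes open_S: "open S"
    and lin: "linear (\<phi> x)"
    and inj: "inj (\<phi> x)"
    and smooth: "smooth_on S (\<lambda>x. \<phi> x v)"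
    and structure_eq: "x \<in> S \<Longrightarrow>
      frechet_derivative (\<lambda>y. \<phi> y v) (at x) u - frechet_derivative (\<lambda>y. \<phi> y u) (at x) v
        = struct (\<phi> x u) (\<phi> x v)"
begin

abbreviation D :: "real^6 \<Rightarrow> real^6 \<Rightarrow> real^6 \<Rightarrow> real^6" where
  "D x u v \<equiv> frechet_derivative (\<lambda>y. \<phi> y v) (at x) u"

lemma \<phi>_has_derivative: "x \<in> S \<Longrightarrow> ((\<lambda>y. \<phi> y v) has_derivative (\<lambda>u. D x u v)) (at x)"
  by (rule smooth_on_has_derivative[OF smooth])

lemma \<phi>_inverse: "\<phi> x (inv_into UNIV (\<phi> x) w) = w"
  using linear_injective_imp_surjective[OF lin inj] by (simp add: surj_f_inv_f)

lemma \<phi>_frame_J: "\<phi> x (frame_J s \<phi> x v) = std_J s (\<phi> x v)"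
  by (simp add: frame_J_def \<phi>_inverse)

text \<open>Transfers identities between tangent vectors to \<open>real^6\<close>, where
  \<open>frame_J\<close> becomes the explicit \<open>std_J\<close>.\<close>

lemma \<phi>_eq_iff: "\<phi> x u = \<phi> x v \<longleftrightarrow> u = v"
  by (rule inj_eq[OF inj])

lemmas \<phi>_linear_simps = linear_add[OF lin] linear_diff[OF lin] linear_neg[OF lin] linear_scale[OF lin]
  linear_0[OF lin]

lemma linear_frame_J: "linear (frame_J s \<phi> x)"
  by (rule linearI) (simp_all add: \<phi>_eq_iff[of x, symmetric] \<phi>_frame_J \<phi>_linear_simps std_J_linear_simps)

lemma frame_J_square: "s^2 = 1 \<Longrightarrow> frame_J s \<phi> x (frame_J s \<phi> x v) = - v"
  by (simp add: \<phi>_eq_iff[of x, symmetric] \<phi>_frame_J \<phi>_linear_simps std_J_square)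

lemma smooth_frame_J: "smooth_on S (\<lambda>x. frame_J s \<phi> x v)"
proof -
  have "linear (inv_into UNIV (\<phi> x))" for x
    by (rule linearI) (simp_all add: \<phi>_eq_iff[of x, symmetric] \<phi>_inverse \<phi>_linear_simps)
  moreover have "smooth_on S (\<lambda>x. inv_into UNIV (\<phi> x) w)" for w
    by (rule smooth_on_inverse_linear_family[OF open_S lin inj smooth])
  moreover have "smooth_on S (\<lambda>x. std_J s (\<phi> x v))"
    by (rule smooth_on_linear_compose[OF open_S bounded_linear_std_J smooth])
  ultimately show ?thesis
    unfolding frame_J_def by (rule smooth_on_linear_family[OF open_S])
qed

lemma frame_metric_bilinear: "bilinear (frame_metric \<phi> x)"
  by (auto simp: bilinear_def frame_metric_def \<phi>_linear_simps inner_add_left inner_add_right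
      intro!: linearI)

lemma frame_metric_pos: "v \<noteq> 0 \<Longrightarrow> frame_metric \<phi> x v v > 0"
  using \<phi>_eq_iff[of x v 0] by (simp add: frame_metric_def \<phi>_linear_simps)

lemma smooth_frame_metric: "smooth_on S (\<lambda>x. frame_metric \<phi> x u v)"
  unfolding frame_metric_def by (rule smooth_on_inner[OF open_S smooth smooth])

lemma frame_metric_hermitian:
  "s^2 = 1 \<Longrightarrow> frame_metric \<phi> x (frame_J s \<phi> x u) (frame_J s \<phi> x v) = frame_metric \<phi> x u v"
  by (simp add: frame_metric_def \<phi>_frame_J std_J_orthogonal)

section \<open>Integrability\<close>

lemma \<phi>_lie_bracket:
  assumes "x \<in> S" "X differentiable (at x)" "Y differentiable (at x)"
  shows "\<phi> x (lie_bracket X Y x) = frechet_derivative (\<lambda>y. \<phi> y (Y y)) (at x) (X x)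
    - frechet_derivative (\<lambda>y. \<phi> y (X y)) (at x) (Y x) - struct (\<phi> x (X x)) (\<phi> x (Y x))"
proof -
  \<comment> \<open>Of the two terms of the product rule, the derivatives of the fields yield the
    bracket and those of the coframe yield \<open>struct\<close>, as in Cartan's formula.\<close>
  have *: "frechet_derivative (\<lambda>y. \<phi> y (Z y)) (at x)
      = (\<lambda>u. D x u (Z x) + \<phi> x (frechet_derivative Z (at x) u))"
    if "Z differentiable (at x)" for Z
    by (rule frechet_derivative_at[symmetric], rule has_derivative_linear_family[OF lin
        \<phi>_has_derivative[OF assms(1)] that[unfolded frechet_derivative_works]])
  show ?thesis
    unfolding *[OF assms(2)] *[OF assms(3)] lie_bracket_def structure_eq[OF assms(1), symmetric]
    by (simp add: \<phi>_linear_simps)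
qed

text \<open>Under \<open>\<phi> x\<close> each bracket becomes derivatives of component functions
  minus \<open>struct\<close>. The derivatives cancel because \<open>std_J s\<close> squares to -1,
  and \<open>struct_std_J\<close> removes the rest.\<close>

lemma nijenhuis_frame_J:
  assumes s: "s^2 = 1" and "smooth_on S X" "smooth_on S Y" and x: "x \<in> S"
  shows "nijenhuis (frame_J s \<phi>) X Y x = 0"
proof -
  let ?J = "frame_J s \<phi>"
  define P where "P Z = frechet_derivative (\<lambda>y. \<phi> y (Z y)) (at x)" for Z
  have smooth_diff: "Z differentiable (at x)" if "smooth_on S Z" for Z :: "real^6 \<Rightarrow> real^6"
    using smooth_on_has_derivative[OF that x] differentiable_def by blast
  have smooth_J: "smooth_on S (\<lambda>y. ?J y (Z y))" if "smooth_on S Z" for Z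
    by (rule smooth_on_linear_family[OF open_S linear_frame_J smooth_frame_J that])
  have bracket: "\<phi> x (lie_bracket V W x) = P W (V x) - P V (W x) - struct (\<phi> x (V x)) (\<phi> x (W x))"
    if "smooth_on S V" "smooth_on S W" for V W
    unfolding P_def using \<phi>_lie_bracket[OF x] that smooth_diff by blast
  \<comment> \<open>The linear map \<open>std_J s\<close> is constant, so it commutes with
    differentiation.\<close>
  have PJ: "P (\<lambda>y. ?J y (Z y)) u = std_J s (P Z u)" if "smooth_on S Z" for Z u
  proof -
    have "((\<lambda>y. \<phi> y (Z y)) has_derivative P Z) (at x)"
      unfolding P_def using smooth_on_linear_family[OF open_S lin smooth that] x
      by (rule smooth_on_has_derivative)
    from frechet_derivative_at[OF bounded_linear.has_derivative[OF bounded_linear_std_J[of s] this]]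
    show ?thesis
      unfolding P_def[of "\<lambda>y. ?J y (Z y)"] \<phi>_frame_J by (metis (lifting))
  qed
  note XY = \<open>smooth_on S X\<close> \<open>smooth_on S Y\<close>
  have "\<phi> x (nijenhuis ?J X Y x) = struct (\<phi> x (X x)) (\<phi> x (Y x))
      - struct (std_J s (\<phi> x (X x))) (std_J s (\<phi> x (Y x)))
      + std_J s (struct (std_J s (\<phi> x (X x))) (\<phi> x (Y x)))
      + std_J s (struct (\<phi> x (X x)) (std_J s (\<phi> x (Y x))))"
    using XY
    by (simp add: nijenhuis_def \<phi>_linear_simps \<phi>_frame_J bracket smooth_J PJ std_J_linear_simps
        std_J_square[OF s])
  also have "\<dots> = 0"
    using struct_std_J[OF s, of "\<phi> x (X x)" "\<phi> x (Y x)"] by (simp add: algebra_simps)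
  finally show ?thesis
    using \<phi>_eq_iff[of x _ 0] by (simp add: \<phi>_linear_simps)
qed

section \<open>The fundamental form and its torsion\<close>

abbreviation F :: "real \<Rightarrow> real^6 \<Rightarrow> (nat \<Rightarrow> real^6) \<Rightarrow> complex" where
  "F s \<equiv> fundamental_form (frame_metric \<phi>) (frame_J s \<phi>)"

lemma F_eq: "F s x v = complex_of_real (std_J s (\<phi> x (v 0)) \<bullet> \<phi> x (v 1))"
  by (simp add: fundamental_form_def frame_metric_def \<phi>_frame_J)

text \<open>The form is invariant under the complex structure, which by \<open>type_part_2\<close>
  means that it has type (1, 1).\<close>

lemma type_part_F:
  assumes s: "s^2 = 1"
  shows "type_part 2 0 (frame_J s \<phi>) (F s) = (\<lambda>_ _. 0)"
    and "type_part 0 2 (frame_J s \<phi>) (F s) = (\<lambda>_ _. 0)"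
    and "type_part 1 1 (frame_J s \<phi>) (F s) = F s"
proof -
  define T where "T x u v = std_J s (\<phi> x u) \<bullet> \<phi> x v" for x u v
  have bil: "bilinear (T x)" for x
    by (auto simp: bilinear_def T_def \<phi>_linear_simps std_J_linear_simps inner_add_left inner_add_right
        intro!: linearI)
  have F: "F s x v = complex_of_real (T x (v 0) (v 1))" for x v
    by (simp add: F_eq T_def)
  have inv: "T x (frame_J s \<phi> x u) (frame_J s \<phi> x v) = T x u v"
    "T x (frame_J s \<phi> x u) v + T x u (frame_J s \<phi> x v) = 0" for x u v
    by (simp_all add: T_def \<phi>_frame_J std_J_skew[of s] std_J_square[OF s])
  note tp = type_part_2[of "F s" _ "T _" "frame_J s \<phi>", OF F bil]
  show "type_part 2 0 (frame_J s \<phi>) (F s) = (\<lambda>_ _. 0)"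
    "type_part 0 2 (frame_J s \<phi>) (F s) = (\<lambda>_ _. 0)"
    using tp(1,2) unfolding inv by (simp_all add: fun_eq_iff)
  show "type_part 1 1 (frame_J s \<phi>) (F s) = F s"
    using tp(3) unfolding inv by (simp add: fun_eq_iff F)
qed

lemma ext_d_F:
  assumes x: "x \<in> S"
  shows "ext_d 2 (F s) x v = complex_of_real (wedge_34_56 2 (\<phi> x (v 0)) (\<phi> x (v 1)) (\<phi> x (v 2)))"
proof -
  have *: "((\<lambda>y. F s y w) has_derivative (\<lambda>u. complex_of_real
      (std_J s (\<phi> x (w 0)) \<bullet> D x u (w 1) + std_J s (D x u (w 0)) \<bullet> \<phi> x (w 1)))) (at x)" for w
    unfolding F_eq
    by (intro has_derivative_of_real has_derivative_inner
        bounded_linear.has_derivative[OF bounded_linear_std_J] \<phi>_has_derivative[OF x])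
  have der: "frechet_derivative (\<lambda>y. F s y w) (at x) u = complex_of_real
      (std_J s (\<phi> x (w 0)) \<bullet> D x u (w 1) + std_J s (D x u (w 0)) \<bullet> \<phi> x (w 1))" for w u
    by (simp only: frechet_derivative_at[OF *, symmetric])
  \<comment> \<open>With every differentiated argument in the first slot, the six terms pair up into
    the three \<open>struct\<close> terms of \<open>struct_fundamental\<close>.\<close>
  have skew: "std_J s (\<phi> x a) \<bullet> D x u b = - (std_J s (D x u b) \<bullet> \<phi> x a)" for a u b
    by (simp only: std_J_skew[of s "\<phi> x a"] inner_commute[of "\<phi> x a"])
  show ?thesis
    unfolding ext_d_2 der skew struct_fundamental[of s, symmetric] structure_eq[OF x, symmetric]
    by (simp add: omit_def numeral_2_eq_2 std_J_linear_simps inner_diff_left)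
qed

text \<open>The factor -1/4 of \<open>type_part_3\<close> meets \<open>4 * s\<close> from
  \<open>wedge_34_56_std_J\<close>. Since the result is odd in \<open>s\<close>, the two torsions
  will cancel.\<close>

lemma dc_F:
  assumes s: "s^2 = 1" and x: "x \<in> S"
  shows "dc 2 (frame_J s \<phi>) (F s) x v
    = complex_of_real (- s * wedge_34_56 1 (\<phi> x (v 0)) (\<phi> x (v 1)) (\<phi> x (v 2)))"
proof -
  define T where "T a b c = wedge_34_56 2 (\<phi> x a) (\<phi> x b) (\<phi> x c)" for a b c
  have T: "ext_d 2 (F s) x v = complex_of_real (T (v 0) (v 1) (v 2))" for v
    by (simp add: ext_d_F[OF x] T_def)
  have T_lin: "linear (\<lambda>a. T a b c)" "linear (\<lambda>b. T a b c)" "linear (\<lambda>c. T a b c)" for a b c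
    by (rule linearI; simp add: T_def \<phi>_linear_simps wedge_34_56_def algebra_simps)+
  show ?thesis
    unfolding dc_2[OF type_part_F(1,3,2)[OF s]] type_part_3[of "ext_d 2 (F s)" x T, OF T T_lin]
    unfolding T_def \<phi>_frame_J wedge_34_56_std_J[OF s] by simp
qed

lemma ext_d_dc_F:
  assumes s: "s^2 = 1" and x: "x \<in> S"
  shows "ext_d 3 (dc 2 (frame_J s \<phi>) (F s)) x v = 0"
proof -
  let ?w = "wedge_34_56 1"
  define h where "h u w = ?w (D x u (w 0)) (\<phi> x (w 1)) (\<phi> x (w 2))
      + ?w (\<phi> x (w 0)) (D x u (w 1)) (\<phi> x (w 2)) + ?w (\<phi> x (w 0)) (\<phi> x (w 1)) (D x u (w 2))"
    for u and w :: "nat \<Rightarrow> real^6"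
  have der: "frechet_derivative (\<lambda>y. dc 2 (frame_J s \<phi>) (F s) y w) (at x) u
      = complex_of_real (- s * h u w)" for w u
  proof -
    have "((\<lambda>y. complex_of_real (- s * ?w (\<phi> y (w 0)) (\<phi> y (w 1)) (\<phi> y (w 2)))) has_derivative
        (\<lambda>u. complex_of_real (- s * h u w))) (at x)"
      unfolding h_def
      by (intro has_derivative_of_real has_derivative_mult_right wedge_34_56_has_derivative
          \<phi>_has_derivative[OF x])
    \<comment> \<open>The formula \<open>dc_F\<close> holds on \<open>S\<close> only, and openness
      carries it over to the derivative.\<close>
    then have *: "((\<lambda>y. dc 2 (frame_J s \<phi>) (F s) y w) has_derivative
        (\<lambda>u. complex_of_real (- s * h u w))) (at x)"
      by (rule has_derivative_transform_within_open[OF _ open_S x]) (simp add: dc_F[OF s])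
    show ?thesis by (simp only: frechet_derivative_at[OF *, symmetric])
  qed
  \<comment> \<open>Again the differentiated arguments move to the first slot; the twelve terms
    merge into the six of \<open>struct_torsion\<close>.\<close>
  have front: "?w (\<phi> x a) (D x u b) r = - ?w (D x u b) (\<phi> x a) r"
    "?w (\<phi> x a) (\<phi> x b) (D x u c) = ?w (D x u c) (\<phi> x a) (\<phi> x b)" for u a b c r
    by (simp_all add: wedge_34_56_def algebra_simps)
  have "h (v 0) (omit 0 v) - h (v 1) (omit 1 v) + h (v 2) (omit 2 v) - h (v 3) (omit 3 v) = 0"
    using struct_torsion[of "\<phi> x (v 0)" "\<phi> x (v 1)" "\<phi> x (v 2)" "\<phi> x (v 3)"]
    unfolding h_def front structure_eq[OF x, symmetric] linear_diff[OF wedge_34_56_linear]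
    by (simp add: omit_def numeral_2_eq_2 numeral_3_eq_3)
  then have "- s * (h (v 0) (omit 0 v) - h (v 1) (omit 1 v) + h (v 2) (omit 2 v) - h (v 3) (omit 3 v)) = 0"
    by simp
  then have "complex_of_real (- s * h (v 0) (omit 0 v)) - complex_of_real (- s * h (v 1) (omit 1 v))
     + complex_of_real (- s * h (v 2) (omit 2 v)) - complex_of_real (- s * h (v 3) (omit 3 v)) = 0"
    unfolding of_real_diff[symmetric] of_real_add[symmetric] of_real_eq_0_iff
    by (simp add: algebra_simps)
  then show ?thesis
    unfolding ext_d_3 der .
qed

end


section \<open>The coframe of left-invariant forms\<close>

lemma cinv_in_cdom: "x \<in> cimg c \<Longrightarrow> cinv c x \<in> cdom c"
  by (simp add: cimg_def cinv_def inv_into_into)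

lemma cmap_cinv: "x \<in> cimg c \<Longrightarrow> cmap c (cinv c x) = x"
  by (simp add: cimg_def cinv_def f_inv_into_f)

text \<open>A proper subspace has a nonzero normal vector, whose coordinates are the coefficients of
  a linear relation between the components of \<phi>.\<close>

lemma nonsurj_linear_orthogonal:
  fixes \<phi> :: "'v::euclidean_space \<Rightarrow> 'v"
  assumes "linear \<phi>" "\<not> surj \<phi>"
  obtains r where "r \<noteq> 0" "\<And>v. r \<bullet> \<phi> v = 0"
proof -
  have "span (range \<phi>) = range \<phi>"
    using linear_subspace_image[OF assms(1) subspace_UNIV] by (simp add: span_eq_iff)
  then have "dim (range \<phi>) \<noteq> DIM('v)"
    using assms(2) dim_eq_full by metis
  then have "dim (range \<phi>) < DIM('v)"
    using dim_subset_UNIV le_neq_implies_less by blast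
  then obtain r where "r \<noteq> 0" "\<And>y. y \<in> span (range \<phi>) \<Longrightarrow> orthogonal r y"
    using orthogonal_to_subspace_exists by blast
  then show thesis
    using that[of r] by (simp add: orthogonal_def span_base)
qed

text \<open>The inverse of \<open>of_nat\<close> on \<open>{1..6}\<close>; note that \<open>6 = 0\<close> in the index type.\<close>

definition index :: "6 \<Rightarrow> nat" where
  "index i = (if i = 1 then 1 else if i = 2 then 2 else if i = 3 then 3
     else if i = 4 then 4 else if i = 5 then 5 else 6)"

lemma index_simps [simp]:
  "index 1 = 1" "index 2 = 2" "index 3 = 3" "index 4 = 4" "index 5 = 5" "index 6 = 6"
  by (simp_all add: index_def)

lemma of_nat_index: "of_nat (index i) = i"
proof -
  have "\<forall>i\<in>UNIV. of_nat (index i) = i" unfolding UNIV_6 by simp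
  then show ?thesis by simp
qed

lemma index_range: "index i \<in> {1..6}"
  by (simp add: index_def)

lemma sum_index: "(\<Sum>j\<in>{1..6}. h j) = (\<Sum>i\<in>UNIV. h (index i))"
proof -
  have "{1..6::nat} = {1, 2, 3, 4, 5, 6}" by auto
  then show ?thesis by (simp add: sum_6 add.assoc)
qed

locale l_group =
  fixes L :: "('a::{t2_space,second_countable_topology}, 'm) monoid_scheme"
    and A :: "('a, real^6) chart set"
    and f :: "nat \<Rightarrow> ('a, real^6, real) form_field"
  assumes lie_group: "lie_group L A"
    and form: "j \<in> {1..6} \<Longrightarrow> form_on A 1 (f j)"
    and left_invariant: "j \<in> {1..6} \<Longrightarrow> left_invariant_form L A (f j)"
    and independent: "\<forall>c\<in>A. \<forall>x\<in>cimg c. \<forall>v. (\<Sum>j\<in>{1..6}. r j * f j c x v) = 0 \<Longrightarrow>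
      j \<in> {1..6} \<Longrightarrow> r j = 0"
    and d1: "c \<in> A \<Longrightarrow> x \<in> cimg c \<Longrightarrow> ext_d 1 (f 1 c) x v = wedge1 (f 1 c) (f 2 c) x v"
    and d2: "c \<in> A \<Longrightarrow> x \<in> cimg c \<Longrightarrow> ext_d 1 (f 2 c) x v = 0"
    and d3456: "c \<in> A \<Longrightarrow> x \<in> cimg c \<Longrightarrow> j \<in> {3, 4, 5, 6} \<Longrightarrow>
      ext_d 1 (f j c) x v = 1/2 * wedge1 (f 2 c) (f j c) x v"
begin

text \<open>Outside the image of the chart the value is arbitrary, but invertible.\<close>

definition frame :: "('a, real^6) chart \<Rightarrow> real^6 \<Rightarrow> real^6 \<Rightarrow> real^6" where
  "frame c x v = (if x \<in> cimg c then \<chi> i. f (index i) c x (\<lambda>_. v) else v)"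

lemma open_cimg: "c \<in> A \<Longrightarrow> open (cimg c)"
  using lie_group by (simp add: lie_group_def smooth_atlas_def)

lemma group_L: "group L"
  using lie_group by (simp add: lie_group_def)

lemma cdom_cover: "(\<Union>c\<in>A. cdom c) = carrier L"
  using lie_group by (simp add: lie_group_def smooth_atlas_def)

lemma form_alternating: "c \<in> A \<Longrightarrow> x \<in> cimg c \<Longrightarrow> alternating_form 1 (f (index i) c x)"
  using form[OF index_range] by (simp add: form_on_def)

text \<open>A 1-form sees only entry 0 of its argument sequence, so the constant sequences in
  \<open>frame\<close> determine it.\<close>

lemma form_const:
  assumes "c \<in> A" "x \<in> cimg c"
  shows "f (index i) c x v = f (index i) c x (\<lambda>_. v 0)"
  by (rule form_alternating[OF assms, unfolded alternating_form_def, THEN conjunct1, rule_format]) simp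

lemma linear_form:
  assumes "c \<in> A" "x \<in> cimg c"
  shows "linear (\<lambda>u. f (index i) c x (\<lambda>_. u))"
proof -
  have "linear (\<lambda>u. f (index i) c x ((\<lambda>_. 0)(0 := u)))"
    by (rule form_alternating[OF assms, unfolded alternating_form_def, THEN conjunct2,
        THEN conjunct1, rule_format]) simp
  then show ?thesis
    by (simp only: form_const[OF assms, of i "(\<lambda>_. 0)(0 := _)"] fun_upd_same)
qed

lemma linear_frame:
  assumes "c \<in> A"
  shows "linear (frame c x)"
proof (cases "x \<in> cimg c")
  case True
  note lin = linear_form[OF assms True]
  show ?thesis
    by (rule linearI) (simp_all add: frame_def True vec_eq_iff linear_add[OF lin] linear_scale[OF lin])
qed (simp add: frame_def linear_iff)

text \<open>The assumption \<open>independent\<close> excludes constant-coefficient relations on the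
  whole group, whereas a coframe requires independence at each point.\<close>

lemma inj_frame:
  assumes c: "c \<in> A"
  shows "inj (frame c x)"
proof (cases "x \<in> cimg c")
  case x: True
  have "surj (frame c x)"
  proof (rule ccontr)
    assume "\<not> surj (frame c x)"
    then obtain r where r: "r \<noteq> 0" "\<And>v. r \<bullet> frame c x v = 0"
      using nonsurj_linear_orthogonal[OF linear_frame[OF c]] by blast
    have *: "(\<Sum>i\<in>UNIV. r$i * f (index i) c x (\<lambda>_. v)) = 0" for v
      using r(2)[of v] x by (simp add: frame_def inner_vec_def)
    have zero: "(\<Sum>i\<in>UNIV. r$i * f (index i) c x v) = 0" for v
      using *[of "v 0"] by (simp only: form_const[OF c x, of _ v])
    \<comment> \<open>The relation at \<open>x\<close> spreads to any \<open>y\<close>: the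
      translation taking \<open>y\<close> to \<open>x\<close> pulls the forms at \<open>x\<close>
      back to those at \<open>y\<close>.\<close>
    have "(\<Sum>j\<in>{1..6}. r $ (of_nat j) * f j d y v) = 0" if d: "d \<in> A" "y \<in> cimg d" for d y v
    proof -
      interpret group L by (rule group_L)
      define p q where "p = cinv c x" and "q = cinv d y"
      have p: "p \<in> cdom c" "cmap c p = x" "p \<in> carrier L" and q: "q \<in> carrier L"
        using cinv_in_cdom[OF x] cmap_cinv[OF x] cinv_in_cdom[OF d(2)] c d(1)
        by (auto simp: p_def q_def cdom_cover[symmetric])
      \<comment> \<open>Left translation by this element sends \<open>q\<close> to
        \<open>p\<close>.\<close>
      define a where "a = p \<otimes>\<^bsub>L\<^esub> inv\<^bsub>L\<^esub> q"
      define h where "h = (\<lambda>b. a \<otimes>\<^bsub>L\<^esub> b)"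
      have "a \<in> carrier L" "h q = p"
        using p q by (simp_all add: a_def h_def m_assoc)
      then have "form_invariant A h (f (index i))" for i
        using left_invariant[OF index_range, of i] by (simp add: left_invariant_form_def h_def)
      moreover have "h (cinv d y) \<in> cdom c" "local_rep d c h y = x"
        using \<open>h q = p\<close> p by (simp_all add: q_def local_rep_def)
      ultimately have "f (index i) c x (\<lambda>k. frechet_derivative (local_rep d c h) (at y) (v k))
          = f (index i) d y v" for i
        using c d unfolding form_invariant_def by metis
      then show ?thesis
        using zero[of "\<lambda>k. frechet_derivative (local_rep d c h) (at y) (v k)"]
        unfolding sum_index of_nat_index by simp
    qed
    then have "r $ (of_nat (index i)) = 0" for i
      using independent[of "\<lambda>j. r $ (of_nat j)"] index_range by blast
    then show False
      using r(1) by (simp add: of_nat_index vec_eq_iff)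
  qed
  then show ?thesis
    by (rule linear_surjective_imp_injective[OF linear_frame[OF c]]) simp
qed (simp add: frame_def inj_on_def)

lemma smooth_form: "c \<in> A \<Longrightarrow> smooth_on (cimg c) (\<lambda>x. f (index i) c x v)"
  using form[OF index_range] by (simp add: form_on_def)

lemma smooth_frame:
  assumes "c \<in> A"
  shows "smooth_on (cimg c) (\<lambda>x. frame c x v)"
  by (rule smooth_on_cong[OF smooth_on_vec[OF open_cimg[OF assms] smooth_form[OF assms]]])
    (auto simp: frame_def open_cimg[OF assms])

lemma coframe_frame:
  assumes c: "c \<in> A"
  shows "coframe (cimg c) (frame c)"
proof (rule coframe.intro)
  fix x u v :: "real^6"
  assume x: "x \<in> cimg c"
  define E where "E i w = frechet_derivative (\<lambda>y. f (index i) c y (\<lambda>_. w)) (at x)" for i w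
  have E: "((\<lambda>y. f (index i) c y z) has_derivative E i (z 0)) (at x)" for i z
  proof -
    have "((\<lambda>y. f (index i) c y (\<lambda>_. z 0)) has_derivative E i (z 0)) (at x)"
      unfolding E_def by (rule smooth_on_has_derivative[OF smooth_form[OF c] x])
    then show ?thesis
      by (rule has_derivative_transform_within_open[OF _ open_cimg[OF c] x])
        (rule form_const[OF c, symmetric])
  qed
  \<comment> \<open>\<open>frame\<close> is given by the forms on the open set \<open>cimg c\<close>
    only, which suffices for derivatives at \<open>x\<close>.\<close>
  have D: "frechet_derivative (\<lambda>y. frame c y w) (at x) z $ i = E i w z" for w z i
  proof -
    have "((\<lambda>y. frame c y w $ i) has_derivative (\<lambda>z. frechet_derivative (\<lambda>y. frame c y w) (at x) z $ i)) (at x)"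
      by (intro bounded_linear.has_derivative[OF bounded_linear_vec_nth]
          smooth_on_has_derivative[OF smooth_frame[OF c] x])
    moreover have "((\<lambda>y. frame c y w $ i) has_derivative E i w) (at x)"
      by (rule has_derivative_transform_within_open[OF E[of i "\<lambda>_. w"] open_cimg[OF c] x])
        (simp add: frame_def)
    ultimately have "(\<lambda>z. frechet_derivative (\<lambda>y. frame c y w) (at x) z $ i) = E i w"
      by (rule has_derivative_unique)
    then show ?thesis by (rule fun_cong)
  qed
  \<comment> \<open>\<open>ext_d 1\<close> and \<open>wedge1\<close> read only the entries 0 and 1,
    here \<open>u\<close> and \<open>v\<close>.\<close>
  define z where "z k = (if k = 0 then u else v)" for k :: nat
  have "ext_d 1 (f (index i) c) x z = E i v u - E i u v" for i
  proof -
    have "frechet_derivative (\<lambda>y. f (index i) c y (omit k z)) (at x) = E i (omit k z 0)" for k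
      using frechet_derivative_at[OF E] by (rule sym)
    then show ?thesis
      by (simp add: ext_d_def) (simp add: omit_def z_def)
  qed
  note dE = this[of 1] this[of 2] this[of 3] this[of 4] this[of 5] this[of 6]
  have wedge: "wedge1 (f (index i) c) (f (index k) c) x z
      = frame c x u $ i * frame c x v $ k - frame c x v $ i * frame c x u $ k" for i k
    using x by (simp add: wedge1_def frame_def z_def)
  note wedge12 = wedge[of 1 2] wedge[of 2 3] wedge[of 2 4] wedge[of 2 5] wedge[of 2 6]
  note d = d1[OF c x, of z] d2[OF c x, of z] d3456[OF c x, of 3 z] d3456[OF c x, of 4 z]
    d3456[OF c x, of 5 z] d3456[OF c x, of 6 z]
  show "frechet_derivative (\<lambda>y. frame c y v) (at x) u - frechet_derivative (\<lambda>y. frame c y u) (at x) v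
      = struct (frame c x u) (frame c x v)"
    unfolding vec_eq_iff_6 vector_minus_component D struct_nth
    using dE d wedge12 unfolding index_simps by (simp add: algebra_simps)
qed (simp_all add: open_cimg linear_frame inj_frame smooth_frame c)

section \<open>Invariance under changes of charts (\<open>h = id\<close>) and left
  translations\<close>

lemma frame_invariant:
  assumes inv: "\<forall>j\<in>{1..6}. form_invariant A h (f j)"
    and "c \<in> A" "d \<in> A" "x \<in> cimg c" "h (cinv c x) \<in> cdom d"
  shows "frame d (local_rep c d h x) (frechet_derivative (local_rep c d h) (at x) v) = frame c x v"
proof -
  have "local_rep c d h x \<in> cimg d"
    using assms by (simp add: local_rep_def cimg_def)
  moreover have "f (index i) d (local_rep c d h x) (\<lambda>_. frechet_derivative (local_rep c d h) (at x) v)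
      = f (index i) c x (\<lambda>_. v)" for i
    using bspec[OF inv index_range, unfolded form_invariant_def, rule_format, OF assms(2-), of i "\<lambda>_. v"] .
  ultimately show ?thesis
    using assms by (simp add: frame_def)
qed

text \<open>The derivative of \<open>h\<close> matches the frames, and in both frames the structure
  is the same \<open>std_J s\<close>; injectivity of the target frame concludes.\<close>

lemma frame_J_invariant:
  assumes "\<forall>j\<in>{1..6}. form_invariant A h (f j)"
  shows "endo_invariant A h (\<lambda>c. frame_J s (frame c))"
  unfolding endo_invariant_def
proof (intro ballI impI allI)
  fix c d x v
  assume cd: "c \<in> A" "d \<in> A" "x \<in> cimg c" "h (cinv c x) \<in> cdom d"
  interpret c: coframe "cimg c" "frame c" by (rule coframe_frame) fact
  interpret d: coframe "cimg d" "frame d" by (rule coframe_frame) fact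
  have frame: "frame d (local_rep c d h x) (frechet_derivative (local_rep c d h) (at x) w) = frame c x w" for w
    by (rule frame_invariant[OF assms cd])
  show "frame_J s (frame d) (local_rep c d h x) (frechet_derivative (local_rep c d h) (at x) v)
      = frechet_derivative (local_rep c d h) (at x) (frame_J s (frame c) x v)"
    by (rule d.\<phi>_eq_iff[of "local_rep c d h x", THEN iffD1])
      (simp add: d.\<phi>_frame_J c.\<phi>_frame_J frame)
qed

lemma frame_metric_invariant:
  assumes "\<forall>j\<in>{1..6}. form_invariant A h (f j)"
  shows "metric_invariant A h (\<lambda>c. frame_metric (frame c))"
  unfolding metric_invariant_def frame_metric_def by (simp add: frame_invariant[OF assms])

lemma form_invariant_id: "\<forall>j\<in>{1..6}. form_invariant A id (f j)"
  using form by (simp add: form_on_def)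

lemma form_invariant_left: "a \<in> carrier L \<Longrightarrow> \<forall>j\<in>{1..6}. form_invariant A (\<lambda>p. a \<otimes>\<^bsub>L\<^esub> p) (f j)"
  using left_invariant by (simp add: left_invariant_form_def)

section \<open>The generalized Kaehler structure on the group\<close>

lemma complex_structure_frame_J:
  assumes s: "s^2 = 1"
  shows "complex_structure_on A (\<lambda>c. frame_J s (frame c))"
  using frame_J_invariant[OF form_invariant_id]
  by (simp add: complex_structure_on_def almost_complex_structure_on_def integrable_complex_on_def
      coframe.linear_frame_J[OF coframe_frame] coframe.frame_J_square[OF coframe_frame s]
      coframe.smooth_frame_J[OF coframe_frame] coframe.nijenhuis_frame_J[OF coframe_frame s])

lemma riemannian_frame_metric: "riemannian_metric_on A (\<lambda>c. frame_metric (frame c))"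
proof -
  have "frame_metric (frame c) x u v = frame_metric (frame c) x v u" for c x u v
    by (simp add: frame_metric_def inner_commute)
  then show ?thesis
    using frame_metric_invariant[OF form_invariant_id]
    by (simp add: riemannian_metric_on_def coframe.frame_metric_bilinear[OF coframe_frame]
        coframe.frame_metric_pos[OF coframe_frame] coframe.smooth_frame_metric[OF coframe_frame])
qed

lemma hermitian_frame_J:
  assumes s: "s^2 = 1"
  shows "hermitian_on A (\<lambda>c. frame_J s (frame c)) (\<lambda>c. frame_metric (frame c))"
  by (simp add: hermitian_on_def coframe.frame_metric_hermitian[OF coframe_frame s])

text \<open>By \<open>dc_F\<close> the torsions for \<open>s = 1\<close> and \<open>s = -1\<close>
  are opposite multiples of one closed 3-form.\<close>

lemma generalized_kaehler_frame:
  "generalized_kaehler_on (carrier L) A (\<lambda>c. frame_J 1 (frame c)) (\<lambda>c. frame_J (-1) (frame c))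
    (\<lambda>c. frame_metric (frame c))"
proof -
  have "smooth_atlas (carrier L) A"
    using lie_group by (simp add: lie_group_def)
  then show ?thesis
    by (simp add: generalized_kaehler_on_def complex_structure_frame_J riemannian_frame_metric
        hermitian_frame_J coframe.dc_F[OF coframe_frame] coframe.ext_d_dc_F[OF coframe_frame])
qed

lemma nontrivial_frame: "nontrivial_pair A (\<lambda>c. frame_J 1 (frame c)) (\<lambda>c. frame_J (-1) (frame c))"
proof -
  have "\<one>\<^bsub>L\<^esub> \<in> carrier L"
    using group_L by (simp add: group.is_monoid monoid.one_closed)
  then obtain c x where c: "c \<in> A" and x: "x \<in> cimg c"
    using cdom_cover unfolding cimg_def by blast
  interpret coframe "cimg c" "frame c" by (rule coframe_frame[OF c])
  \<comment> \<open>Vectors of the dual frame. The structures send \<open>e 1\<close> to opposite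
    nonzero vectors and agree on \<open>e 3\<close> with a nonzero value, which excludes equality
    and opposition.\<close>
  define e where "e i = inv_into UNIV (frame c x) (axis i 1)" for i
  have "frame c x (frame_J (-1) (frame c) x (e 1)) \<noteq> frame c x (frame_J 1 (frame c) x (e 1))"
    "frame c x (frame_J (-1) (frame c) x (e 3)) \<noteq> frame c x (- frame_J 1 (frame c) x (e 3))"
    by (simp_all add: \<phi>_linear_simps \<phi>_frame_J e_def \<phi>_inverse vec_eq_iff_6 axis_def)
  then show ?thesis
    using c x unfolding nontrivial_pair_def by metis
qed

end

theorem proposition4p1:
  fixes L :: "('a::{t2_space,second_countable_topology}, 'm) monoid_scheme"
    and A :: "('a, real^6) chart set"
  assumes "lie_group L A"
    and "simply_connected (carrier L)"
    and "has_lie_algebra_l L A"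
  shows "\<exists>Jp Jm g.
      left_invariant_endo L A Jp \<and> left_invariant_endo L A Jm \<and> left_invariant_metric L A g \<and>
      generalized_kaehler_on (carrier L) A Jp Jm g \<and> nontrivial_pair A Jp Jm"
proof -
  obtain f :: "nat \<Rightarrow> ('a, real^6, real) form_field" where "l_group L A f"
    using assms(1,3) unfolding has_lie_algebra_l_def l_group_def by blast
  then interpret l_group L A f .
  show ?thesis
    using frame_J_invariant[OF form_invariant_left] frame_metric_invariant[OF form_invariant_left]
      generalized_kaehler_frame nontrivial_frame
    unfolding left_invariant_endo_def left_invariant_metric_def by blast
qed

end
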